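(* For $n\ge1$ let $P_{n}^{(\mathrm{pk},\mathrm{ides})}(s,t)=\sum_{\pi\in\mathfrak{S}_{n}}s^{\mathrm{pk}(\pi)+1}t^{\mathrm{ides}(\pi)+1}$. Then: (a) As formal power series, \[ \frac{1}{(1-s)(1-t)}+\frac{1}{2}\sum_{n=1}^{\infty}\left(\frac{1+s}{(1-s)(1-t)}\right)^{n+1}P_{n}^{(\mathrm{pk},\mathrm{ides})}\left(\frac{4s}{(1+s)^{2}},t\right)x^n =\sum_{i,j=0}^{\infty}\left(\frac{1+x}{1-x}\right)^{ij}s^{i}t^{j}. \] (b) For all $n\geq1$, \[ \left(\frac{1+s}{(1-s)(1-t)}\right)^{n+1}P_{n}^{(\mathrm{pk},\mathrm{ides})}\left(\frac{4s}{(1+s)^{2}},t\right)=2\sum_{i,j=0}^{\infty}\sum_{k=0}^{n}\binom{ij}{k}\binom{ij+n-k-1}{n-k}s^{i}t^{j}. \] (c) For all $n\geq1$, \[ \left(\frac{1+s}{(1-s)(1-t)}\right)^{n+1}P_{n}^{(\mathrm{pk},\mathrm{ides})}\left(\frac{4s}{(1+s)^{2}},t\right) =\frac{1}{n!}\sum_{k=0}^n 2^{k+1} d(n,k)\frac{A_{k}(s)A_{k}(t)}{(1-s)^{k+1}(1-t)^{k+1}}. \]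
   Context: $\mathfrak{S}_n$ is the symmetric group on $[n]$. For $\pi\in\mathfrak{S}_n$, $i\in[n-1]$ is a descent if $\pi(i)>\pi(i+1)$ and $\mathrm{des}(\pi)$ is the number of descents; $\mathrm{ides}(\pi)=\mathrm{des}(\pi^{-1})$; an index $i$ with $2\le i\le n-1$ is a peak if $\pi(i-1)<\pi(i)>\pi(i+1)$ and $\mathrm{pk}(\pi)$ is the number of peaks. The Eulerian polynomials are $A_n(t)=\sum_{\pi\in\mathfrak{S}_n}t^{\mathrm{des}(\pi)+1}$ for $n\ge1$ and $A_0(t)=1$. $d(n,k)$ is the number of permutations in $\mathfrak{S}_n$ with exactly $k$ cycles, all of odd length (with $d(0,0)=1$). *)

theory Defs
  imports
    "HOL-Computational_Algebra.Formal_Power_Series"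
    "HOL-Combinatorics.Permutations"
    "HOL-Combinatorics.Orbits"
begin

unbundle fps_syntax

definition des :: "nat \<Rightarrow> (nat \<Rightarrow> nat) \<Rightarrow> nat" where
  "des n \<pi> = card {i \<in> {1..n - 1}. \<pi> i > \<pi> (i + 1)}"

definition ides :: "nat \<Rightarrow> (nat \<Rightarrow> nat) \<Rightarrow> nat" where
  "ides n \<pi> = des n (inv \<pi>)"

definition pk :: "nat \<Rightarrow> (nat \<Rightarrow> nat) \<Rightarrow> nat" where
  "pk n \<pi> = card {i \<in> {2..n - 1}. \<pi> (i - 1) < \<pi> i \<and> \<pi> i > \<pi> (i + 1)}"

text \<open>
  The polynomials are represented by their evaluation maps on an arbitrary commutative ring,
  so that power series can be substituted for the variables.
\<close>

definition eulerian_poly :: "nat \<Rightarrow> 'a::comm_ring_1 \<Rightarrow> 'a" where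
  "eulerian_poly n t =
     (if n = 0 then 1 else (\<Sum>\<pi> | \<pi> permutes {1..n}. t ^ (des n \<pi> + 1)))"

definition pk_ides_poly :: "nat \<Rightarrow> 'a::comm_ring_1 \<Rightarrow> 'a \<Rightarrow> 'a" where
  "pk_ides_poly n s t = (\<Sum>\<pi> | \<pi> permutes {1..n}. s ^ (pk n \<pi> + 1) * t ^ (ides n \<pi> + 1))"

text \<open>
  The cycles of \<open>\<pi>\<close> on \<open>[n]\<close>, fixed points included, are the orbits of the elements of \<open>[n]\<close>.
\<close>

definition odd_cycle_number :: "nat \<Rightarrow> nat \<Rightarrow> nat" where
  "odd_cycle_number n k =
     card {\<pi>. \<pi> permutes {1..n} \<and> card (orbit \<pi> ` {1..n}) = k \<and>
              (\<forall>C \<in> orbit \<pi> ` {1..n}. odd (card C))}"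

text \<open>
  Formal power series in \<open>x, s, t\<close> over the rationals: \<open>F $ n $ i $ j\<close> is the coefficient
  of \<open>x\<^sup>n s\<^sup>i t\<^sup>j\<close>.
\<close>

type_synonym fps3 = "rat fps fps fps"

definition X\<^sub>x :: fps3 where "X\<^sub>x = fps_X"
definition X\<^sub>s :: fps3 where "X\<^sub>s = fps_const fps_X"
definition X\<^sub>t :: fps3 where "X\<^sub>t = fps_const (fps_const fps_X)"

text \<open>
  Infinite sums of formal power series are taken coefficientwise. The metric on
  \<^typ>\<open>'a fps\<close> is not suitable here: on the nested type it is the adic metric of the
  outermost variable only.
\<close>

definition formal_summable :: "('i \<Rightarrow> fps3) \<Rightarrow> 'i set \<Rightarrow> bool" where
  "formal_summable f I \<longleftrightarrow> (\<forall>n i j. finite {l \<in> I. f l $ n $ i $ j \<noteq> 0})"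

definition formal_sum :: "('i \<Rightarrow> fps3) \<Rightarrow> 'i set \<Rightarrow> fps3" where
  "formal_sum f I = Abs_fps (\<lambda>n. Abs_fps (\<lambda>i. Abs_fps (\<lambda>j.
     \<Sum>l | l \<in> I \<and> f l $ n $ i $ j \<noteq> 0. f l $ n $ i $ j)))"

text \<open>
  On the nested type, the library division by a series with nonzero constant term is the
  usual one.
\<close>

lemma fps3_divide_mult:
  fixes f g :: fps3
  assumes "g $ 0 $ 0 $ 0 \<noteq> 0"
  shows "f / g * g = f"
proof -
  have 1: "g $ 0 $ 0 * inverse (g $ 0 $ 0) = 1"
    using assms by (rule inverse_mult_eq_1')
  have 2: "g $ 0 * inverse (g $ 0) = 1"
    unfolding fps_inverse_def[of "g $ 0"] by (rule fps_right_inverse[OF 1])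
  have 3: "g * inverse g = 1"
    unfolding fps_inverse_def[of g] by (rule fps_right_inverse[OF 2])
  have "g $ 0 \<noteq> 0"
    using assms by auto
  then have "f / g = f * inverse g"
    by (rule fps_divide_unit)
  then show ?thesis
    using 3 by (simp add: mult.assoc mult.commute)
qed

end

theory Submission
  imports Defs
begin

text \<open>
  All three identities say that the coefficient of \<open>s\<^sup>p t\<^sup>q\<close> in the scaled polynomial is twice
  the coefficient of \<open>x\<^sup>n\<close> in \<open>((1 + x) / (1 - x))\<^bsup>p q\<^esup>\<close>.

  Standardization maps each word of length \<open>n\<close> over \<open>{1..q}\<close> to a permutation with the same descent
  set, and the fibre of \<open>\<pi>\<close> has as many elements as the coefficient of \<open>t\<^sup>q\<close> in
  \<open>t\<^bsup>ides \<pi> + 1\<^esup> / (1 - t)\<^bsup>n + 1\<^esup>\<close>; so sums over permutations weighted by \<open>ides\<close> become sums over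
  words. For a fixed word, \<open>(1/2) ((1 + s) / (1 - s))\<^bsup>n + 1\<^esup> (4 s / (1 + s)\<^sup>2)\<^bsup>pk + 1\<^esup>\<close> is the
  generating function of Stembridge's enriched P-partitions, namely weakly increasing sequences in
  \<open>-1 < 1 < -2 < 2 < \<dots>\<close> that may repeat a positive value only at an ascent and a negative value
  only at a descent. Summed over all words this splits into blocks that are weakly increasing
  (factor \<open>(1 - x)\<^bsup>-q\<^esup>\<close>) or strictly decreasing (factor \<open>(1 + x)\<^sup>q\<close>), one of each for every value up
  to \<open>p\<close>.

  The Eulerian form follows because standardization with trivial weight gives
  \<open>\<Sum>\<^sub>i i\<^sup>k s\<^sup>i = A\<^sub>k(s) / (1 - s)\<^bsup>k + 1\<^esup>\<close>, and because deleting an element and its image from a cycle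
  of length at least three gives the count of permutations with odd cycles the recurrence that
  \<open>(1 - x\<^sup>2) G' = 2 y G\<close> gives the coefficients of \<open>G = ((1 + x) / (1 - x))\<^sup>y\<close>.
\<close>

section \<open>The series (1 + x) / (1 - x)\<close>

text \<open>The geometric series \<open>1 / (1 - x)\<close>, given by its coefficients so that it is
  available over every commutative ring, including rings of power series.\<close>

definition fps_ones :: "'a::comm_ring_1 fps" where
  "fps_ones = Abs_fps (\<lambda>_. 1)"

lemma fps_ones_nth [simp]: "fps_ones $ n = 1"
  by (simp add: fps_ones_def)

lemma fps_ones_times_one_minus_X [simp]: "fps_ones * (1 - fps_X) = 1"
  by (rule fps_ext) (simp add: right_diff_distrib)

lemma one_minus_X_times_fps_ones [simp]: "(1 - fps_X) * fps_ones = 1"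
  by (metis fps_ones_times_one_minus_X mult.commute)

lemma fps_ones_eq: "fps_ones = 1 + fps_X * fps_ones"
  using one_minus_X_times_fps_ones by (simp add: algebra_simps)

lemma mult_fps_ones_nth: "(f * fps_ones) $ n = (\<Sum>k\<le>n. f $ k)"
  by (simp add: fps_mult_nth atLeast0AtMost)

lemma one_plus_X_power_nth:
  "((1 + fps_X) ^ N :: 'a::comm_ring_1 fps) $ k = of_nat (N choose k)"
proof (induction N arbitrary: k)
  case (Suc N)
  then show ?case
    by (cases k) (simp_all add: distrib_right)
qed (simp add: binomial_eq_0)

text \<open>Multiplying by \<open>fps_ones\<close> takes partial sums, so the double induction is
  Pascal's rule. For \<open>N = 0\<close> truncated subtraction still gives 1 at
  \<open>k = 0\<close> and 0 elsewhere.\<close>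

lemma fps_ones_power_nth:
  "(fps_ones ^ N :: 'a::comm_ring_1 fps) $ k = of_nat (N + k - 1 choose k)"
proof (induction N arbitrary: k)
  case 0
  then show ?case by (cases k) (simp_all add: binomial_eq_0)
next
  case IH: (Suc N)
  show ?case
  proof (induction k)
    case 0
    have "(fps_ones ^ Suc N :: 'a fps) $ 0 = (\<Sum>i\<le>0. (fps_ones ^ N :: 'a fps) $ i)"
      by (simp only: power_Suc2 mult_fps_ones_nth)
    then show ?case using IH[of 0] by simp
  next
    case (Suc k)
    have "(fps_ones ^ Suc N :: 'a fps) $ Suc k
        = (fps_ones ^ Suc N :: 'a fps) $ k + (fps_ones ^ N :: 'a fps) $ Suc k"
      by (simp only: power_Suc2 mult_fps_ones_nth sum.atMost_Suc)
    also have "\<dots> = of_nat (N + k choose k) + of_nat (N + k choose Suc k)"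
      using Suc.IH IH[of "Suc k"] by simp
    finally show ?case by simp
  qed
qed

section \<open>Coefficients of the powers of \<open>(1 + x) / (1 - x)\<close>\<close>

definition cayley_coeff :: "nat \<Rightarrow> nat \<Rightarrow> nat" where
  "cayley_coeff N n = (\<Sum>k = 0..n. (N choose k) * (N + n - k - 1 choose (n - k)))"

definition cayley_fps :: "'a::comm_ring_1 fps" where
  "cayley_fps = (1 + fps_X) * fps_ones"

lemma cayley_fps_power_nth: "(cayley_fps ^ N :: 'a::comm_ring_1 fps) $ n = of_nat (cayley_coeff N n)"
  by (simp add: cayley_fps_def cayley_coeff_def power_mult_distrib fps_mult_nth
      one_plus_X_power_nth fps_ones_power_nth)

lemma cayley_coeff_0 [simp]: "cayley_coeff N 0 = 1"
  by (simp add: cayley_coeff_def)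

lemma cayley_coeff_1 [simp]: "cayley_coeff N (Suc 0) = 2 * N"
  by (simp add: cayley_coeff_def)

text \<open>The series \<open>C = (1 + x) / (1 - x)\<close> satisfies
  \<open>(1 - x^2) C' = 2 C\<close>, hence \<open>(1 - x^2) (C^N)' = 2 N C^N\<close>; the recurrence
  compares the coefficients at \<open>n + 1\<close>.\<close>

lemma cayley_coeff_Suc_Suc:
  "(n + 2) * cayley_coeff N (n + 2) = 2 * N * cayley_coeff N (n + 1) + n * cayley_coeff N n"
proof -
  let ?C = "cayley_fps :: rat fps"
  have [simp]: "fps_deriv fps_ones = (fps_ones ^ 2 :: rat fps)"
  proof -
    have "fps_deriv ((1 - fps_X) * fps_ones :: rat fps) = 0" by simp
    then have "(1 - fps_X) * fps_deriv fps_ones = (fps_ones :: rat fps)"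
      by (simp del: one_minus_X_times_fps_ones)
    then have "fps_ones * ((1 - fps_X) * fps_deriv fps_ones) = (fps_ones * fps_ones :: rat fps)"
      by simp
    then show ?thesis
      by (simp add: mult.assoc[symmetric] power2_eq_square)
  qed
  have ones: "fps_X * fps_ones = (fps_ones - 1 :: rat fps)"
    using fps_ones_eq[where 'a = rat] by (simp add: algebra_simps)
  have C: "(1 - fps_X\<^sup>2) * fps_deriv ?C = 2 * ?C"
  proof -
    have "(1 - fps_X\<^sup>2) * fps_deriv ?C
        = (1 + fps_X) * ((1 - fps_X) * fps_ones) * (1 + (1 + fps_X) * fps_ones)"
      by (simp add: cayley_fps_def power2_eq_square del: one_minus_X_times_fps_ones)
         (simp add: algebra_simps)
    also have "1 + (1 + fps_X) * fps_ones = (2 * fps_ones :: rat fps)"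
      using ones by (simp add: algebra_simps)
    finally show ?thesis by (simp add: cayley_fps_def mult_ac)
  qed
  have "(1 - fps_X\<^sup>2) * fps_deriv (?C ^ N) = fps_const (2 * of_nat N) * ?C ^ N"
  proof (cases N)
    case (Suc M)
    show ?thesis
    proof -
      have "(1 - fps_X\<^sup>2) * fps_deriv (?C ^ N)
          = fps_const (of_nat N) * ((1 - fps_X\<^sup>2) * fps_deriv ?C) * ?C ^ M"
        unfolding fps_deriv_power by (simp add: Suc mult_ac del: power_Suc)
      also have "\<dots> = fps_const (of_nat N) * (2 * ?C ^ N)"
        unfolding C by (simp only: Suc power_Suc mult_ac)
      also have "\<dots> = fps_const (2 * of_nat N) * ?C ^ N"
        by (simp add: mult.assoc[symmetric] numeral_fps_const mult.commute)
      finally show ?thesis .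
    qed
  qed simp
  then have "((1 - fps_X\<^sup>2) * fps_deriv (?C ^ N)) $ (n + 1) = (fps_const (2 * of_nat N) * ?C ^ N) $ (n + 1)"
    by simp
  then have "rat_of_nat ((n + 2) * cayley_coeff N (n + 2))
      = rat_of_nat (2 * N * cayley_coeff N (n + 1) + n * cayley_coeff N n)"
    by (cases n) (simp_all add: left_diff_distrib fps_X_power_mult_nth fps_X_power_mult_right_nth cayley_fps_power_nth algebra_simps)
  then show ?thesis
    by (simp only: of_nat_eq_iff)
qed

section \<open>Enriched P-partitions\<close>

text \<open>
  The two components count enriched P-partitions of a sequence of \<open>m + 1\<close> letters with descents \<open>D\<close>
  by the absolute value of the last entry, which is positive in the first component and negative in
  the second.
\<close>

primrec enriched_fps :: "(nat \<Rightarrow> bool) \<Rightarrow> nat \<Rightarrow> rat fps \<times> rat fps" where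
  "enriched_fps D 0 = (fps_X * fps_ones, fps_X * fps_ones)"
| "enriched_fps D (Suc m) =
     (let (P, M) = enriched_fps D m in
      if D (Suc m) then ((fps_X * P + M) * fps_ones, (fps_X * P + M) * fps_ones)
      else ((P + M) * fps_ones, fps_X * (P + M) * fps_ones))"

lemma enriched_fps_cong:
  "(\<And>i. i \<in> {1..m} \<Longrightarrow> D i = D' i) \<Longrightarrow> enriched_fps D m = enriched_fps D' m"
  by (induction m) auto

definition peaks :: "(nat \<Rightarrow> bool) \<Rightarrow> nat \<Rightarrow> nat" where
  "peaks D m = card {i \<in> {2..m}. \<not> D (i - 1) \<and> D i}"

lemma peaks_Suc: "peaks D (Suc m) = peaks D m + (if m > 0 \<and> \<not> D m \<and> D (Suc m) then 1 else 0)"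
proof -
  have "{i \<in> {2..Suc m}. \<not> D (i - 1) \<and> D i}
      = (if m > 0 \<and> \<not> D m \<and> D (Suc m) then insert (Suc m) else id) {i \<in> {2..m}. \<not> D (i - 1) \<and> D i}"
    by (auto simp: le_Suc_eq)
  then show ?thesis
    unfolding peaks_def by simp
qed

text \<open>After a descent, \<open>b\<close> and \<open>-b\<close> can follow exactly the same
  entries; after an ascent, \<open>-b\<close> can follow exactly the entries that
  \<open>b - 1\<close> can, whence the factor \<open>fps_X\<close>. So one series determines the
  pair.\<close>

lemma enriched_fps_shape:
  "if m = 0 \<or> D m then snd (enriched_fps D m) = fst (enriched_fps D m)
   else snd (enriched_fps D m) = fps_X * fst (enriched_fps D m)"
  by (cases m) (auto simp: Let_def split: prod.splits)

definition peak_weight :: "rat fps" where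
  "peak_weight = 4 * fps_X * inverse (1 + fps_X) ^ 2"

lemma peak_weight_mult: "peak_weight * (1 + fps_X) * (1 + fps_X) = 4 * fps_X"
proof -
  have "inverse (1 + fps_X) * (1 + fps_X) = (1 :: rat fps)"
    by (rule inverse_mult_eq_1) simp
  then have "(inverse (1 + fps_X) * (1 + fps_X)) ^ 2 = (1 :: rat fps)"
    by simp
  then show ?thesis
    unfolding peak_weight_def by (simp add: power_mult_distrib power2_eq_square mult_ac)
qed

text \<open>Each step multiplies the total by \<open>cayley_fps\<close>, except at a peak: there the
  total \<open>(1 + x) P\<close> becomes \<open>4 x P / (1 - x)\<close>, and the additional factor
  is exactly \<open>peak_weight\<close>.\<close>

lemma enriched_fps_total:
  "fst (enriched_fps D m) + snd (enriched_fps D m)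
     = 2 * fps_X * fps_ones * cayley_fps ^ m * peak_weight ^ peaks D m"
proof (induction m)
  case 0
  show ?case by (simp add: peaks_def)
next
  case (Suc m)
  obtain P M where PM: "enriched_fps D m = (P, M)" by fastforce
  define T where "T = P + M"
  have shape: "M = (if m = 0 \<or> D m then P else fps_X * P)"
    using enriched_fps_shape[of m D] PM by auto
  have "fst (enriched_fps D (Suc m)) + snd (enriched_fps D (Suc m))
      = T * cayley_fps * (if m > 0 \<and> \<not> D m \<and> D (Suc m) then peak_weight else 1)"
  proof (cases "m > 0 \<and> \<not> D m \<and> D (Suc m)")
    case True
    have "T * cayley_fps * peak_weight = P * fps_ones * (peak_weight * (1 + fps_X) * (1 + fps_X))"
      using True by (simp add: T_def shape cayley_fps_def algebra_simps)
    also have "\<dots> = P * fps_ones * (4 * fps_X)"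
      by (simp only: peak_weight_mult)
    finally show ?thesis
      using True by (simp add: PM shape algebra_simps)
  next
    case False
    then show ?thesis
      by (auto simp add: PM T_def shape cayley_fps_def algebra_simps)
  qed
  then show ?case
    using Suc by (simp add: T_def PM peaks_Suc mult_ac)
qed

text \<open>The last \<open>fps_ones\<close> relaxes "last absolute value equal to" into "at most".
  Since \<open>(1 + x)^2 * peak_weight = 4 x\<close>, the prefactor \<open>4 x / (1 - x)^2\<close>
  is \<open>cayley_fps^2 * peak_weight\<close>; for \<open>n = m + 1\<close> this gives the
  exponents \<open>n + 1\<close> and \<open>pk + 1\<close>.\<close>

lemma enriched_fps_total_sums:
  "2 * ((fst (enriched_fps D m) + snd (enriched_fps D m)) * fps_ones)
     = cayley_fps ^ (m + 2) * peak_weight ^ (peaks D m + 1)"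
proof -
  have "cayley_fps ^ (m + 2) * peak_weight ^ (peaks D m + 1)
      = cayley_fps ^ m * peak_weight ^ peaks D m * fps_ones * fps_ones
        * (peak_weight * (1 + fps_X) * (1 + fps_X))"
    by (simp add: cayley_fps_def power_mult_distrib power2_eq_square mult_ac)
  then show ?thesis
    unfolding peak_weight_mult enriched_fps_total by (auto simp: mult_ac)
qed

section \<open>Summing the enriched series over all words\<close>

abbreviation words :: "nat \<Rightarrow> nat \<Rightarrow> (nat \<Rightarrow> nat) set" where
  "words n j \<equiv> {1..n} \<rightarrow>\<^sub>E {1..j}"

lemma sum_words_Suc:
  "(\<Sum>w\<in>words (Suc n) j. F w) = (\<Sum>b\<in>{1..j}. \<Sum>w\<in>words n j. F (w(Suc n := b)))"
proof -
  have "{1..Suc n} = insert (Suc n) {1..n}" by auto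
  then have "words (Suc n) j = (\<lambda>(b, w). w(Suc n := b)) ` ({1..j} \<times> words n j)"
    by (simp add: PiE_insert_eq)
  moreover have "inj_on (\<lambda>(b, w). w(Suc n := b)) ({1..j} \<times> words n j)"
    by (rule inj_combinator) simp
  ultimately show ?thesis
    by (simp add: sum.reindex sum.cartesian_product case_prod_unfold)
qed

definition descent :: "(nat \<Rightarrow> nat) \<Rightarrow> nat \<Rightarrow> bool" where
  "descent w i \<longleftrightarrow> w i > w (Suc i)"

text \<open>The fixed last letter \<open>b\<close> is what decides whether the next letter makes a
  descent, so these sums obey a transfer recursion. A positive last entry lies in a weakly
  increasing block (up), a negative one in a strictly decreasing block (down).\<close>

definition up_sum :: "nat \<Rightarrow> nat \<Rightarrow> nat \<Rightarrow> rat fps" where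
  "up_sum j m b = (\<Sum>w\<in>words m j. fst (enriched_fps (descent (w(Suc m := b))) m))"

definition down_sum :: "nat \<Rightarrow> nat \<Rightarrow> nat \<Rightarrow> rat fps" where
  "down_sum j m b = (\<Sum>w\<in>words m j. snd (enriched_fps (descent (w(Suc m := b))) m))"

lemma up_down_sum_0: "up_sum j 0 b = fps_X * fps_ones" "down_sum j 0 b = fps_X * fps_ones"
  by (simp_all add: up_sum_def down_sum_def)

lemma enriched_fps_descent_upd:
  "enriched_fps (descent (w(Suc m := a, Suc (Suc m) := b))) m = enriched_fps (descent (w(Suc m := a))) m"
  by (rule enriched_fps_cong) (simp add: descent_def)

lemma up_down_sum_Suc:
  "up_sum j (Suc m) b = (\<Sum>a\<in>{1..j}. if b < a then (fps_X * up_sum j m a + down_sum j m a) * fps_ones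
     else (up_sum j m a + down_sum j m a) * fps_ones)" (is ?up)
  "down_sum j (Suc m) b = (\<Sum>a\<in>{1..j}. if b < a then (fps_X * up_sum j m a + down_sum j m a) * fps_ones
     else fps_X * (up_sum j m a + down_sum j m a) * fps_ones)" (is ?down)
proof -
  show ?up
    unfolding up_sum_def sum_words_Suc down_sum_def
    by (intro sum.cong refl)
       (simp add: enriched_fps_descent_upd case_prod_unfold Let_def descent_def[of _ "Suc m"]
         sum.distrib sum_distrib_left sum_distrib_right distrib_right)
  show ?down
    unfolding up_sum_def sum_words_Suc down_sum_def
    by (intro sum.cong refl)
       (simp add: enriched_fps_descent_upd case_prod_unfold Let_def descent_def[of _ "Suc m"]
         sum.distrib sum_distrib_left sum_distrib_right distrib_right distrib_left)
qed

text \<open>Telescopes by \<open>x * fps_ones = fps_ones - 1\<close>. It sorts the nonempty weakly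
  increasing words over \<open>{1..b}\<close> by their last letter \<open>a\<close>.\<close>

lemma X_sum_fps_ones_power: "fps_X * (\<Sum>a\<in>{1..b}. fps_ones ^ a) = (fps_ones ^ b - 1 :: rat fps)"
proof (induction b)
  case (Suc b)
  have "fps_X * (\<Sum>a\<in>{1..Suc b}. fps_ones ^ a) = fps_ones ^ b - 1 + fps_ones ^ b * (fps_X * fps_ones :: rat fps)"
    using Suc by (simp add: distrib_left mult_ac)
  also have "fps_X * fps_ones = (fps_ones - 1 :: rat fps)"
    using fps_ones_eq[where 'a = rat] by (simp add: algebra_simps)
  finally show ?case by (simp add: algebra_simps)
qed simp

text \<open>The counterpart for nonempty strictly decreasing words over \<open>{b<..j}\<close>:
  above a last letter \<open>a\<close> the other letters form any subset of
  \<open>{a<..j}\<close>.\<close>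

lemma X_sum_one_plus_X_power:
  "fps_X * (\<Sum>a\<in>{b<..j}. (1 + fps_X) ^ (j - a)) = ((1 + fps_X) ^ (j - b) - 1 :: rat fps)"
proof (induction j)
  case (Suc j)
  show ?case
  proof (cases "b \<le> j")
    case True
    then have "{b<..Suc j} = insert (Suc j) {b<..j}" by auto
    then have "(\<Sum>a\<in>{b<..Suc j}. (1 + fps_X) ^ (Suc j - a))
        = 1 + (\<Sum>a\<in>{b<..j}. (1 + fps_X) ^ (Suc j - a) :: rat fps)"
      by simp
    also have "(\<Sum>a\<in>{b<..j}. (1 + fps_X) ^ (Suc j - a) :: rat fps)
        = (1 + fps_X) * (\<Sum>a\<in>{b<..j}. (1 + fps_X) ^ (j - a))"
      by (simp add: sum_distrib_left Suc_diff_le)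
    finally have "fps_X * (\<Sum>a\<in>{b<..Suc j}. (1 + fps_X) ^ (Suc j - a))
      = fps_X + (1 + fps_X) * (fps_X * (\<Sum>a\<in>{b<..j}. (1 + fps_X) ^ (j - a) :: rat fps))"
      by (simp add: algebra_simps)
    then show ?thesis
      unfolding Suc using True by (simp add: Suc_diff_le algebra_simps)
  next
    case False
    then show ?thesis by simp
  qed
qed simp

text \<open>Separates the smaller absolute values from the value \<open>i + 1\<close> itself; the
  factor \<open>fps_X\<close> drops the latter, which encodes a forbidden repetition.\<close>

lemma mult_fps_ones_nth_Suc:
  assumes "f $ 0 = 0"
  shows "(f * fps_ones) $ Suc i = (\<Sum>k<i. f $ Suc k) + f $ Suc i"
    and "(fps_X * f * fps_ones) $ Suc i = (\<Sum>k<i. f $ Suc k)"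
proof -
  have *: "(f * fps_ones) $ n = (\<Sum>k<n. f $ Suc k)" for n
    using assms by (induction n) (simp_all add: mult_fps_ones_nth)
  show "(f * fps_ones) $ Suc i = (\<Sum>k<i. f $ Suc k) + f $ Suc i"
    by (simp add: *)
  show "(fps_X * f * fps_ones) $ Suc i = (\<Sum>k<i. f $ Suc k)"
    by (simp add: mult.assoc *)
qed

text \<open>On the left \<open>fps_X\<close> marks the absolute value of the last entry, on the
  right the letters of the word. Each of the absolute values up to \<open>i\<close> contributes two
  blocks, together \<open>cayley_fps ^ j\<close>. If the last entry is \<open>i + 1\<close>, then
  \<open>-(i + 1)\<close> adds a strictly decreasing block and the final block increases weakly up
  to \<open>b\<close>; if it is \<open>-(i + 1)\<close>, the final block decreases strictly down to
  \<open>b\<close>.\<close>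

lemma up_down_sum_nth:
  defines "U j \<equiv> (1 + fps_X) ^ j :: rat fps"
  assumes "b \<in> {1..j}"
  shows "up_sum j m b $ 0 = 0 \<and> down_sum j m b $ 0 = 0 \<and>
    (\<forall>i. up_sum j m b $ Suc i = (fps_X * cayley_fps ^ (i * j) * U j * fps_ones ^ b) $ Suc m \<and>
         down_sum j m b $ Suc i = (fps_X * cayley_fps ^ (i * j) * U (j - b)) $ Suc m)"
  using assms(2)
proof (induction m arbitrary: b)
  case 0
  then show ?case
    by (simp add: up_down_sum_0 mult.assoc U_def fps_power_zeroth cayley_fps_def)
next
  case (Suc m)
  define H where "H = (cayley_fps ^ j :: rat fps)"
  have Hi: "cayley_fps ^ (i * j) = H ^ i" for i
    by (metis H_def power_mult mult.commute)
  have HU: "H = U j * fps_ones ^ j"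
    by (simp add: H_def cayley_fps_def U_def power_mult_distrib)
  define p where "p k a = fps_X * H ^ k * U j * fps_ones ^ a" for k a
  define q where "q k a = fps_X * H ^ k * U (j - a)" for k a
  have zero: "up_sum j m a $ 0 = 0" "down_sum j m a $ 0 = 0" if "a \<in> {1..j}" for a
    using Suc.IH[OF that] by auto
  have IH: "up_sum j m a $ Suc i = p i a $ Suc m" "down_sum j m a $ Suc i = q i a $ Suc m"
    if "a \<in> {1..j}" for a i
    using Suc.IH[OF that] by (auto simp: p_def q_def Hi)
  have S: "(up_sum j m a * fps_ones) $ Suc i = (\<Sum>k<i. p k a $ Suc m) + p i a $ Suc m"
    "(fps_X * up_sum j m a * fps_ones) $ Suc i = (\<Sum>k<i. p k a $ Suc m)"
    "(down_sum j m a * fps_ones) $ Suc i = (\<Sum>k<i. q k a $ Suc m) + q i a $ Suc m"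
    "(fps_X * down_sum j m a * fps_ones) $ Suc i = (\<Sum>k<i. q k a $ Suc m)"
    if "a \<in> {1..j}" for a i
    by (simp_all only: mult_fps_ones_nth_Suc[OF zero(1)[OF that]]
        mult_fps_ones_nth_Suc[OF zero(2)[OF that]] IH[OF that])
  have p_sum: "(\<Sum>a\<in>{1..c}. p k a) = H ^ k * U j * (fps_ones ^ c - 1)" for k c
    unfolding p_def X_sum_fps_ones_power[symmetric] by (simp add: sum_distrib_left mult_ac)
  have q_sum: "(\<Sum>a\<in>{c<..j}. q k a) = H ^ k * (U (j - c) - 1)" for k c
    unfolding q_def U_def X_sum_one_plus_X_power[symmetric] by (simp add: sum_distrib_left mult_ac)
  have q_sum': "(\<Sum>a\<in>{1..j}. q k a) = H ^ k * (U j - 1)" for k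
    using q_sum[of k 0] by (simp add: atLeastSucAtMost_greaterThanAtMost)
  \<comment> \<open>Summed over all last letters, the two blocks of one absolute value turn
    \<open>H ^ k\<close> into \<open>H ^ Suc k\<close>, so the differences telescope.\<close>
  have tot: "(\<Sum>k<i. \<Sum>a\<in>{1..j}. p k a + q k a) = H ^ i - 1" for i
  proof -
    have "(\<Sum>a\<in>{1..j}. p k a + q k a) = H ^ k * (U j * fps_ones ^ j) - H ^ k" for k
      unfolding sum.distrib p_sum q_sum' by (simp add: algebra_simps)
    then have "(\<Sum>a\<in>{1..j}. p k a + q k a) = H ^ Suc k - H ^ k" for k
      unfolding HU[symmetric] by (simp add: mult.commute)
    then show ?thesis
      by (simp only: sum_lessThan_telescope power_0)
  qed
  have swap: "(\<Sum>k<i. \<Sum>a\<in>{1..j}. p k a + q k a) = (\<Sum>a\<in>{1..j}. \<Sum>k<i. p k a + q k a)" for i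
    by (rule sum.swap)
  have b: "{a \<in> {1..j}. b < a} = {b<..j}" "{a \<in> {1..j}. \<not> b < a} = {1..b}"
    using Suc.prems by auto
  have "up_sum j (Suc m) b $ Suc i = (H ^ i * U j * fps_ones ^ b - 1) $ Suc m" for i
  proof -
    \<comment> \<open>The entry before a last entry \<open>i + 1\<close> has smaller absolute value,
      or is \<open>-(i + 1)\<close>, or is \<open>i + 1\<close> itself if \<open>a\<close> to
      \<open>b\<close> is no descent.\<close>
    have "up_sum j (Suc m) b $ Suc i
        = (\<Sum>a\<in>{1..j}. (\<Sum>k<i. p k a + q k a) + q i a + (if b < a then 0 else p i a)) $ Suc m"
      unfolding up_down_sum_Suc fps_sum_nth
      by (intro sum.cong refl)
         (simp add: S fps_sum_nth sum.distrib distrib_right distrib_left)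
    also have "(\<Sum>a\<in>{1..j}. (\<Sum>k<i. p k a + q k a) + q i a + (if b < a then 0 else p i a))
        = (\<Sum>k<i. \<Sum>a\<in>{1..j}. p k a + q k a) + (\<Sum>a\<in>{1..j}. q i a) + (\<Sum>a\<in>{1..b}. p i a)"
      unfolding swap by (simp add: sum.distrib sum.If_cases b[simplified] Int_def)
    also have "\<dots> = H ^ i * U j * fps_ones ^ b - 1"
      unfolding tot q_sum' p_sum by (simp add: algebra_simps)
    finally show ?thesis .
  qed
  moreover have "down_sum j (Suc m) b $ Suc i = (H ^ i * U (j - b) - 1) $ Suc m" for i
  proof -
    \<comment> \<open>The entry before \<open>-(i + 1)\<close> has smaller absolute value, or equals
      it at a descent.\<close>
    have "down_sum j (Suc m) b $ Suc i
        = (\<Sum>a\<in>{1..j}. (\<Sum>k<i. p k a + q k a) + (if b < a then q i a else 0)) $ Suc m"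
      unfolding up_down_sum_Suc fps_sum_nth
      by (intro sum.cong refl)
         (simp add: S fps_sum_nth sum.distrib distrib_right distrib_left)
    also have "(\<Sum>a\<in>{1..j}. (\<Sum>k<i. p k a + q k a) + (if b < a then q i a else 0))
        = (\<Sum>k<i. \<Sum>a\<in>{1..j}. p k a + q k a) + (\<Sum>a\<in>{b<..j}. q i a)"
      unfolding swap by (simp add: sum.distrib sum.If_cases b[simplified] Int_def)
    also have "\<dots> = H ^ i * U (j - b) - 1"
      unfolding tot q_sum by (simp add: algebra_simps)
    finally show ?thesis .
  qed
  moreover have "up_sum j (Suc m) b $ 0 = 0" "down_sum j (Suc m) b $ 0 = 0"
    unfolding up_down_sum_Suc fps_sum_nth by (auto intro!: sum.neutral simp: zero)
  \<comment> \<open>The factor \<open>fps_X\<close> of the claim lowers the index by one, and the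
    \<open>- 1\<close>, which stands for the empty word, does not reach the coefficient
    \<open>Suc m\<close>.\<close>
  ultimately show ?case
    by (simp add: Hi mult.assoc)
qed

text \<open>Last entries of absolute value \<open>k + 1\<close> contribute
  \<open>H ^ Suc k - H ^ k\<close>. The factor \<open>fps_ones\<close> adds these up for
  \<open>k < i\<close>, which leaves \<open>H ^ i - 1\<close>.\<close>

lemma sum_words_enriched_fps:
  "(\<Sum>w\<in>words (Suc m) j. ((fst (enriched_fps (descent w) m) + snd (enriched_fps (descent w) m)) * fps_ones) $ i)
     = of_nat (cayley_coeff (i * j) (Suc m))"
proof -
  define f where "f = (\<Sum>b\<in>{1..j}. up_sum j m b + down_sum j m b)"
  define H where "H = (cayley_fps ^ j :: rat fps)"
  have Hi: "cayley_fps ^ (i * j) = H ^ i" for i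
    by (metis H_def power_mult mult.commute)
  have HU: "H = (1 + fps_X) ^ j * fps_ones ^ j"
    by (simp add: H_def cayley_fps_def power_mult_distrib)
  have "(\<Sum>w\<in>words (Suc m) j. ((fst (enriched_fps (descent w) m) + snd (enriched_fps (descent w) m)) * fps_ones) $ i)
      = (f * fps_ones) $ i"
    unfolding f_def up_sum_def down_sum_def sum_words_Suc
    by (simp add: fps_sum_nth[symmetric] sum_distrib_right sum.distrib distrib_right)
  also have "f $ 0 = 0"
    unfolding f_def fps_sum_nth by (rule sum.neutral) (use up_down_sum_nth in simp)
  then have "(f * fps_ones) $ i = (\<Sum>k<i. f $ Suc k)"
    using mult_fps_ones_nth_Suc(2)[of f i] by (simp add: mult.assoc)
  also have "\<dots> = (\<Sum>k<i. (H ^ Suc k - H ^ k) $ Suc m)"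
  proof (intro sum.cong refl)
    fix k
    have "f $ Suc k = (\<Sum>b\<in>{1..j}. (fps_X * H ^ k * (1 + fps_X) ^ j * fps_ones ^ b) $ Suc m
        + (fps_X * H ^ k * (1 + fps_X) ^ (j - b)) $ Suc m)"
      unfolding f_def fps_sum_nth
      by (rule sum.cong) (use up_down_sum_nth in \<open>auto simp: Hi\<close>)
    also have "\<dots> = (H ^ k * (1 + fps_X) ^ j * (fps_X * (\<Sum>b\<in>{1..j}. fps_ones ^ b))
        + H ^ k * (fps_X * (\<Sum>b\<in>{0<..j}. (1 + fps_X) ^ (j - b)))) $ Suc m"
      by (simp only: fps_add_nth[symmetric] fps_sum_nth[symmetric])
         (simp add: sum.distrib sum_distrib_left mult_ac atLeastSucAtMost_greaterThanAtMost)
    also have "\<dots> = (H ^ Suc k - H ^ k) $ Suc m"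
      unfolding X_sum_fps_ones_power X_sum_one_plus_X_power by (simp add: HU algebra_simps)
    finally show "f $ Suc k = (H ^ Suc k - H ^ k) $ Suc m" .
  qed
  also have "(\<Sum>k<i. (H ^ Suc k - H ^ k) $ Suc m) = (H ^ i - 1) $ Suc m"
    unfolding fps_sum_nth[symmetric] sum_lessThan_telescope by simp
  also have "\<dots> = of_nat (cayley_coeff (i * j) (Suc m))"
    by (simp add: Hi[symmetric] cayley_fps_power_nth)
  finally show ?thesis .
qed

section \<open>Standardization\<close>

text \<open>The ordinary P-partitions of a labelled chain with descents \<open>D\<close>. They are
  the sorted forms of the words with a given standardization, \<open>D\<close> being the descents of
  the inverse permutation.\<close>

definition descent_chains :: "(nat \<Rightarrow> bool) \<Rightarrow> nat \<Rightarrow> nat \<Rightarrow> (nat \<Rightarrow> nat) set" where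
  "descent_chains D n j = {f \<in> words n j. \<forall>k\<in>{1..<n}. if D k then f k < f (Suc k) else f k \<le> f (Suc k)}"

lemma descent_chains_step:
  "f \<in> descent_chains D n j \<Longrightarrow> 1 \<le> k \<Longrightarrow> k < n \<Longrightarrow> if D k then f k < f (Suc k) else f k \<le> f (Suc k)"
  by (simp add: descent_chains_def)

lemma descent_chains_mono:
  assumes "f \<in> descent_chains D n j" "1 \<le> k" "k \<le> l" "l \<le> n"
  shows "f k \<le> f l"
  using assms(3,4)
proof (induction l rule: dec_induct)
  case (step r)
  then have "f r \<le> f (Suc r)"
    using descent_chains_step[OF assms(1), of r] assms(2) by (auto split: if_splits)
  with step show ?case by simp
qed simp

lemma finite_words [simp]: "finite (words n j)"
  by (simp add: finite_PiE)

lemma finite_chains [simp]: "finite (descent_chains D n j)"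
  unfolding descent_chains_def by (rule finite_subset[OF _ finite_words]) blast

text \<open>Splits off the last value \<open>b\<close>. Since the chain increases weakly, a bound on
  the value before it, \<open>b\<close> or at a strict step \<open>b - 1\<close>, bounds all the
  others.\<close>

lemma card_chains_Suc_Suc:
  "card (descent_chains D (Suc (Suc m)) j)
     = (\<Sum>b\<in>{1..j}. card (descent_chains D (Suc m) (if D (Suc m) then b - 1 else b)))"
proof -
  let ?n = "Suc m"
  define u where "u b = (if D ?n then b - 1 else b)" for b :: nat
  let ?g = "\<lambda>(b, f). f(Suc ?n := b)"
  have "bij_betw ?g (SIGMA b:{1..j}. descent_chains D ?n (u b)) (descent_chains D (Suc ?n) j)"
  proof (rule bij_betw_imageI)
    have "(SIGMA b:{1..j}. descent_chains D ?n (u b)) \<subseteq> UNIV \<times> ({1..?n} \<rightarrow>\<^sub>E UNIV)"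
      by (auto simp: descent_chains_def)
    moreover have "inj_on ?g (UNIV \<times> ({1..?n} \<rightarrow>\<^sub>E UNIV))"
      by (rule inj_combinator[where T = "\<lambda>_. UNIV"]) simp
    ultimately show "inj_on ?g (SIGMA b:{1..j}. descent_chains D ?n (u b))"
      by (rule inj_on_subset[rotated])
    show "?g ` (SIGMA b:{1..j}. descent_chains D ?n (u b)) = descent_chains D (Suc ?n) j"
    proof (intro equalityI subsetI)
      fix f assume "f \<in> ?g ` (SIGMA b:{1..j}. descent_chains D ?n (u b))"
      then obtain b h where b: "b \<in> {1..j}" and h: "h \<in> descent_chains D ?n (u b)" and f: "f = h(Suc ?n := b)"
        by auto
      have hb: "h k \<in> {1..u b}" if "k \<in> {1..?n}" for k
        using h that by (auto simp: descent_chains_def dest: PiE_mem)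
      have "u b \<le> j" "u b \<le> b" using b by (auto simp: u_def)
      have last: "if D ?n then h ?n < b else h ?n \<le> b"
        using hb[of ?n] by (auto simp: u_def split: if_splits)
      have "f \<in> words (Suc ?n) j"
      proof (rule PiE_I)
        fix k assume k: "k \<in> {1..Suc ?n}"
        show "f k \<in> {1..j}"
        proof (cases "k = Suc ?n")
          case False
          then show ?thesis using k hb[of k] \<open>u b \<le> j\<close> f by auto
        qed (use b f in auto)
      next
        fix k assume "k \<notin> {1..Suc ?n}"
        then show "f k = undefined"
          using h f by (auto simp: descent_chains_def PiE_def extensional_def)
      qed
      moreover have "if D k then f k < f (Suc k) else f k \<le> f (Suc k)" if "k \<in> {1..<Suc ?n}" for k
      proof (cases "k = ?n")
        case False
        then have "k \<in> {1..<?n}" using that by auto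
        then show ?thesis using h f by (auto simp: descent_chains_def)
      qed (use last f in auto)
      ultimately show "f \<in> descent_chains D (Suc ?n) j" by (auto simp: descent_chains_def)
    next
      fix f assume f: "f \<in> descent_chains D (Suc ?n) j"
      define b where "b = f (Suc ?n)"
      define h where "h = f(Suc ?n := undefined)"
      have fw: "f k \<in> {1..j}" if "k \<in> {1..Suc ?n}" for k
        using f that by (auto simp: descent_chains_def dest: PiE_mem)
      have "f ?n \<le> u b"
        using descent_chains_step[OF f, of ?n] by (auto simp: b_def u_def split: if_splits)
      then have le: "f k \<le> u b" if "k \<in> {1..?n}" for k
        using descent_chains_mono[OF f, of k ?n] that by auto
      have "h \<in> words ?n (u b)"
        using le fw f by (auto simp: h_def descent_chains_def PiE_def extensional_def)
      then have "h \<in> descent_chains D ?n (u b)"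
        using f by (auto simp: descent_chains_def h_def)
      moreover have "f = h(Suc ?n := b)" by (simp add: h_def b_def)
      moreover have "b \<in> {1..j}" using fw by (simp add: b_def)
      ultimately show "f \<in> ?g ` (SIGMA b:{1..j}. descent_chains D ?n (u b))" by force
    qed
  qed
  then have "card (descent_chains D (Suc ?n) j) = card (SIGMA b:{1..j}. descent_chains D ?n (u b))"
    by (metis bij_betw_same_card)
  then show ?thesis by (simp add: u_def)
qed

text \<open>In the variable marking the bound \<open>j\<close>, summing over the last value is a
  factor \<open>fps_ones\<close> and a strict step a factor \<open>fps_X\<close>. The base case is
  \<open>x / (1 - x)^2\<close>, the series of the numbers \<open>j\<close>.\<close>

lemma card_chains:
  "rat_of_nat (card (descent_chains D (Suc m) j))
     = (fps_X ^ (card {k \<in> {1..m}. D k} + 1) * fps_ones ^ (m + 2)) $ j"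
proof (induction m arbitrary: j)
  case 0
  have "descent_chains D (Suc 0) j = words (Suc 0) j" by (auto simp: descent_chains_def)
  then have "card (descent_chains D (Suc 0) j) = j"
    by (simp add: card_funcsetE)
  moreover have "(fps_X * fps_ones ^ 2 :: rat fps) $ j = of_nat j"
    by (cases j) (simp_all add: fps_ones_power_nth)
  ultimately show ?case by (simp add: power2_eq_square)
next
  case (Suc m)
  let ?d = "card {k \<in> {1..m}. D k}"
  let ?F = "fps_X ^ (?d + 1) * fps_ones ^ (m + 2) :: rat fps"
  have d: "card {k \<in> {1..Suc m}. D k} = ?d + (if D (Suc m) then 1 else 0)"
  proof -
    have "{k \<in> {1..Suc m}. D k} = (if D (Suc m) then insert (Suc m) else id) {k \<in> {1..m}. D k}"
      by (auto simp: le_Suc_eq)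
    then show ?thesis by simp
  qed
  have F0: "?F $ 0 = 0" by simp
  have "rat_of_nat (card (descent_chains D (Suc (Suc m)) j))
      = (\<Sum>b\<in>{1..j}. ?F $ (if D (Suc m) then b - 1 else b))"
    unfolding card_chains_Suc_Suc of_nat_sum Suc.IH ..
  \<comment> \<open>The series has no constant term, so the sum may start at \<open>b = 0\<close>
    and is then a coefficient of a product with \<open>fps_ones\<close>.\<close>
  also have "\<dots> = (\<Sum>b\<le>j. ((if D (Suc m) then fps_X else 1) * ?F) $ b)"
  proof (rule sum.mono_neutral_cong_left)
    show "\<forall>b\<in>{..j} - {1..j}. ((if D (Suc m) then fps_X else 1) * ?F) $ b = 0"
      using F0 by (auto simp: not_le)
    show "?F $ (if D (Suc m) then b - 1 else b) = ((if D (Suc m) then fps_X else 1) * ?F) $ b"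
      if "b \<in> {1..j}" for b
    proof -
      have "(fps_X * ?F) $ b = ?F $ (b - 1)" using that by (simp add: mult.assoc)
      then show ?thesis by simp
    qed
  qed auto
  also have "\<dots> = ((if D (Suc m) then fps_X else 1) * ?F * fps_ones) $ j"
    by (simp only: mult_fps_ones_nth)
  also have "(if D (Suc m) then fps_X else 1) * ?F * fps_ones
      = fps_X ^ (card {k \<in> {1..Suc m}. D k} + 1) * fps_ones ^ (Suc m + 2)"
    unfolding d by (simp add: mult_ac)
  finally show ?case .
qed

text \<open>The words whose standardization, with ties broken from left to right, is \<open>\<pi>\<close>.\<close>

definition std_words :: "nat \<Rightarrow> nat \<Rightarrow> (nat \<Rightarrow> nat) \<Rightarrow> (nat \<Rightarrow> nat) set" where
  "std_words n j \<pi> = {w \<in> words n j. \<forall>p\<in>{1..n}. \<forall>q\<in>{1..n}.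
     \<pi> p < \<pi> q \<longrightarrow> w p < w q \<or> w p = w q \<and> p < q}"

text \<open>Composition with \<open>inv \<pi>\<close> sorts the word. Neighbours in sorted order may
  agree only if their positions increase, that is, where \<open>inv \<pi>\<close> has no
  descent.\<close>

lemma card_std_words:
  assumes \<pi>: "\<pi> permutes {1..Suc m}"
  shows "card (std_words (Suc m) j \<pi>) = card (descent_chains (descent (inv \<pi>)) (Suc m) j)"
proof -
  let ?n = "Suc m"
  have inv: "inv \<pi> permutes {1..?n}" using \<pi> by (rule permutes_inv)
  have in1: "\<pi> k \<in> {1..?n} \<longleftrightarrow> k \<in> {1..?n}" for k using permutes_in_image[OF \<pi>] .
  have in2: "inv \<pi> k \<in> {1..?n} \<longleftrightarrow> k \<in> {1..?n}" for k using permutes_in_image[OF inv] .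
  have c1: "\<pi> (inv \<pi> k) = k" "inv \<pi> (\<pi> k) = k" for k using permutes_inverses[OF \<pi>] .
  have comp: "w \<circ> inv \<pi> \<in> words ?n j" "w \<circ> \<pi> \<in> words ?n j" if "w \<in> words ?n j" for w
    using that in1 in2 by (auto simp: PiE_def extensional_def Pi_def)
  have "bij_betw (\<lambda>w. w \<circ> inv \<pi>) (std_words ?n j \<pi>) (descent_chains (descent (inv \<pi>)) ?n j)"
  proof (rule bij_betw_byWitness[where f' = "\<lambda>f. f \<circ> \<pi>"])
    show "(\<lambda>w. w \<circ> inv \<pi>) ` std_words ?n j \<pi> \<subseteq> descent_chains (descent (inv \<pi>)) ?n j"
    proof safe
      fix w assume w: "w \<in> std_words ?n j \<pi>"
      have "if descent (inv \<pi>) k then (w \<circ> inv \<pi>) k < (w \<circ> inv \<pi>) (Suc k)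
          else (w \<circ> inv \<pi>) k \<le> (w \<circ> inv \<pi>) (Suc k)" if k: "k \<in> {1..<?n}" for k
      proof -
        have "k \<in> {1..?n}" "Suc k \<in> {1..?n}" using k by auto
        then have "inv \<pi> k \<in> {1..?n}" "inv \<pi> (Suc k) \<in> {1..?n}" using in2 by auto
        moreover have "\<pi> (inv \<pi> k) < \<pi> (inv \<pi> (Suc k))" by (simp add: c1)
        ultimately have "w (inv \<pi> k) < w (inv \<pi> (Suc k)) \<or>
            w (inv \<pi> k) = w (inv \<pi> (Suc k)) \<and> inv \<pi> k < inv \<pi> (Suc k)"
          using w unfolding std_words_def by blast
        then show ?thesis by (auto simp: descent_def)
      qed
      then show "w \<circ> inv \<pi> \<in> descent_chains (descent (inv \<pi>)) ?n j"
        using w comp unfolding descent_chains_def std_words_def by blast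
    qed
    show "(\<lambda>f. f \<circ> \<pi>) ` descent_chains (descent (inv \<pi>)) ?n j \<subseteq> std_words ?n j \<pi>"
    proof safe
      fix f assume f: "f \<in> descent_chains (descent (inv \<pi>)) ?n j"
      \<comment> \<open>From neighbours to all pairs: equal values at \<open>k < l\<close> make
        every step between them weak, so \<open>inv \<pi>\<close> increases from \<open>k\<close> to
        \<open>l\<close>.\<close>
      have *: "f k < f l \<or> f k = f l \<and> inv \<pi> k < inv \<pi> l" if "k < l" "1 \<le> k" "l \<le> ?n" for k l
        using that
      proof (induction l)
        case (Suc l)
        have s: "if descent (inv \<pi>) l then f l < f (Suc l) else f l \<le> f (Suc l)"
          using f Suc.prems by (auto simp: descent_chains_def)
        have ne: "inv \<pi> l \<noteq> inv \<pi> (Suc l)" by (metis c1(1) n_not_Suc_n)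
        show ?case
        proof (cases "k = l")
          case True
          then show ?thesis using s ne by (auto simp: descent_def split: if_splits)
        next
          case False
          then have "f k < f l \<or> f k = f l \<and> inv \<pi> k < inv \<pi> l" using Suc by simp
          then show ?thesis using s ne by (auto simp: descent_def split: if_splits)
        qed
      qed simp
      have "(f \<circ> \<pi>) p < (f \<circ> \<pi>) q \<or> (f \<circ> \<pi>) p = (f \<circ> \<pi>) q \<and> p < q"
        if "p \<in> {1..?n}" "q \<in> {1..?n}" "\<pi> p < \<pi> q" for p q
        using *[of "\<pi> p" "\<pi> q"] that in1[of p] in1[of q] by (simp add: c1)
      then show "f \<circ> \<pi> \<in> std_words ?n j \<pi>"
        using f comp unfolding descent_chains_def std_words_def by blast
    qed
  qed (auto simp: fun_eq_iff c1)
  then show ?thesis by (rule bij_betw_same_card)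
qed

text \<open>Order the positions by letter, then from left to right, and send each position to its
  rank. Any other candidate induces the same order on positions, and a permutation of
  \<open>{1..n}\<close> is determined by that order.\<close>

lemma ex1_std_words:
  assumes "w \<in> words n j"
  shows "\<exists>!\<pi>. \<pi> permutes {1..n} \<and> w \<in> std_words n j \<pi>"
proof -
  define L where "L q p \<longleftrightarrow> w q < w p \<or> w q = w p \<and> q < p" for p q
  have L_trans: "L p q \<Longrightarrow> L q r \<Longrightarrow> L p r" for p q r by (auto simp: L_def)
  have L_irrefl: "\<not> L p p" for p by (auto simp: L_def)
  have L_total: "p \<noteq> q \<Longrightarrow> L p q \<or> L q p" for p q by (auto simp: L_def)
  define \<pi> where "\<pi> p = (if p \<in> {1..n} then Suc (card {q \<in> {1..n}. L q p}) else p)" for p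
  have mono: "\<pi> p < \<pi> q" if "p \<in> {1..n}" "q \<in> {1..n}" "L p q" for p q
  proof -
    have "{r \<in> {1..n}. L r p} \<subset> {r \<in> {1..n}. L r q}"
      using that L_trans L_irrefl by blast
    then have "card {r \<in> {1..n}. L r p} < card {r \<in> {1..n}. L r q}"
      by (intro psubset_card_mono) auto
    then show ?thesis using that by (simp add: \<pi>_def)
  qed
  have inj: "inj_on \<pi> {1..n}"
  proof (rule inj_onI, rule ccontr)
    fix p q assume "p \<in> {1..n}" "q \<in> {1..n}" "\<pi> p = \<pi> q" "p \<noteq> q"
    then show False using mono[of p q] mono[of q p] L_total[of p q] by auto
  qed
  have "\<pi> ` {1..n} \<subseteq> {1..n}"
  proof safe
    fix p assume p: "p \<in> {1..n}"
    then have "{q \<in> {1..n}. L q p} \<subset> {1..n}" using L_irrefl by blast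
    then have "card {q \<in> {1..n}. L q p} < card {1..n}" by (intro psubset_card_mono) auto
    then show "\<pi> p \<in> {1..n}" using p by (simp add: \<pi>_def)
  qed
  then have "\<pi> ` {1..n} = {1..n}" using inj by (simp add: endo_inj_surj)
  then have perm: "\<pi> permutes {1..n}"
    using inj by (intro bij_imp_permutes) (auto simp: bij_betw_def \<pi>_def)
  have std: "w \<in> std_words n j \<sigma> \<longleftrightarrow> (\<forall>p\<in>{1..n}. \<forall>q\<in>{1..n}. \<sigma> p < \<sigma> q \<longrightarrow> L p q)" for \<sigma>
    using assms by (auto simp: std_words_def L_def)
  have "w \<in> std_words n j \<pi>"
    unfolding std using mono L_total by (metis less_asym less_irrefl)
  moreover have "\<sigma> = \<pi>" if \<sigma>: "\<sigma> permutes {1..n}" and w: "w \<in> std_words n j \<sigma>" for \<sigma>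
  proof
    fix p
    show "\<sigma> p = \<pi> p"
    proof (cases "p \<in> {1..n}")
      case True
      have iff: "\<sigma> q < \<sigma> p \<longleftrightarrow> L q p" if "q \<in> {1..n}" for q
        using w[unfolded std] that True L_trans L_irrefl permutes_inj[OF \<sigma>]
        by (metis injD linorder_neqE_nat)
      have "{q \<in> {1..n}. L q p} = {q \<in> {1..n}. \<sigma> q < \<sigma> p}" using iff by blast
      \<comment> \<open>These positions are counted through their values, which are all the values
        below \<open>\<sigma> p\<close>.\<close>
      also have "\<sigma> ` \<dots> = {1..<\<sigma> p}"
      proof (intro equalityI subsetI)
        fix r assume r: "r \<in> {1..<\<sigma> p}"
        have "\<sigma> p \<in> {1..n}" using permutes_in_image[OF \<sigma>] True by blast
        then have "r \<in> {1..n}" using r by auto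
        then have "r \<in> \<sigma> ` {1..n}" by (simp only: permutes_image[OF \<sigma>])
        then show "r \<in> \<sigma> ` {q \<in> {1..n}. \<sigma> q < \<sigma> p}" using r by auto
      next
        fix r assume "r \<in> \<sigma> ` {q \<in> {1..n}. \<sigma> q < \<sigma> p}"
        then show "r \<in> {1..<\<sigma> p}" using permutes_in_image[OF \<sigma>] by auto
      qed
      finally have "card {q \<in> {1..n}. L q p} = card {1..<\<sigma> p}"
        using card_image[OF permutes_inj_on[OF \<sigma>]] by metis
      moreover have "\<sigma> p \<ge> 1" using permutes_in_image[OF \<sigma>, of p] True by auto
      ultimately show ?thesis using True by (simp add: \<pi>_def)
    next
      case False
      then show ?thesis using permutes_not_in[OF \<sigma> False] by (simp only: \<pi>_def if_False)
    qed
  qed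
  ultimately show ?thesis using perm by blast
qed

text \<open>Equal letters are numbered from left to right, so a tie at \<open>i\<close> is an ascent
  of \<open>\<pi>\<close>.\<close>

lemma descent_std_words:
  assumes "\<pi> permutes {1..n}" "w \<in> std_words n j \<pi>" "i \<in> {1..<n}"
  shows "descent w i \<longleftrightarrow> descent \<pi> i"
proof -
  have i: "i \<in> {1..n}" "Suc i \<in> {1..n}" using assms(3) by auto
  have "\<pi> i \<noteq> \<pi> (Suc i)" using permutes_inj[OF assms(1)] by (metis injD n_not_Suc_n)
  then consider "\<pi> i < \<pi> (Suc i)" | "\<pi> (Suc i) < \<pi> i" by linarith
  then show ?thesis
  proof cases
    case 1
    then have "w i < w (Suc i) \<or> w i = w (Suc i)" using assms(2) i unfolding std_words_def by blast
    then show ?thesis using 1 by (auto simp: descent_def)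
  next
    case 2
    then have "w (Suc i) < w i \<or> w (Suc i) = w i \<and> Suc i < i" using assms(2) i unfolding std_words_def by blast
    then show ?thesis using 2 by (auto simp: descent_def)
  qed
qed

lemma ides_eq_card: "ides (Suc m) \<pi> = card {k \<in> {1..m}. descent (inv \<pi>) k}"
  by (simp add: ides_def des_def descent_def)

text \<open>Words are partitioned by their standardization. The fibre of \<open>\<pi>\<close> is
  counted by the chains for \<open>inv \<pi>\<close>, and \<open>F\<close>, constant on it, can be
  evaluated at \<open>\<pi>\<close> itself.\<close>

lemma sum_words_by_standardization:
  fixes F :: "(nat \<Rightarrow> nat) \<Rightarrow> rat"
  assumes "\<And>w \<pi>. \<pi> permutes {1..Suc m} \<Longrightarrow> w \<in> std_words (Suc m) j \<pi> \<Longrightarrow> F w = F \<pi>"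
  shows "(\<Sum>w\<in>words (Suc m) j. F w)
     = (\<Sum>\<pi> | \<pi> permutes {1..Suc m}. F \<pi> * (fps_X ^ (ides (Suc m) \<pi> + 1) * fps_ones ^ (m + 2)) $ j)"
proof -
  let ?P = "{\<pi>. \<pi> permutes {1..Suc m}}"
  have words: "words (Suc m) j = (\<Union>\<pi>\<in>?P. std_words (Suc m) j \<pi>)"
  proof
    show "words (Suc m) j \<subseteq> (\<Union>\<pi>\<in>?P. std_words (Suc m) j \<pi>)"
    proof
      fix w assume "w \<in> words (Suc m) j"
      from ex1_implies_ex[OF ex1_std_words[OF this]]
      show "w \<in> (\<Union>\<pi>\<in>?P. std_words (Suc m) j \<pi>)" by simp
    qed
    show "(\<Union>\<pi>\<in>?P. std_words (Suc m) j \<pi>) \<subseteq> words (Suc m) j"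
      by (rule UN_least) (simp add: std_words_def)
  qed
  have "(\<Sum>w\<in>words (Suc m) j. F w) = (\<Sum>\<pi>\<in>?P. \<Sum>w\<in>std_words (Suc m) j \<pi>. F w)"
    unfolding words
  proof (rule sum.UNION_disjoint)
    show "finite ?P" by (simp add: finite_permutations)
    show "\<forall>\<pi>\<in>?P. finite (std_words (Suc m) j \<pi>)"
      unfolding std_words_def by (intro ballI finite_subset[OF _ finite_words[of "Suc m" j]]) blast
    show "\<forall>\<pi>\<in>?P. \<forall>\<sigma>\<in>?P. \<pi> \<noteq> \<sigma> \<longrightarrow> std_words (Suc m) j \<pi> \<inter> std_words (Suc m) j \<sigma> = {}"
    proof (intro ballI impI equals0I)
      fix \<pi> \<sigma> w
      assume "\<pi> \<in> ?P" "\<sigma> \<in> ?P" "\<pi> \<noteq> \<sigma>"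
        and w: "w \<in> std_words (Suc m) j \<pi> \<inter> std_words (Suc m) j \<sigma>"
      moreover from w have "w \<in> words (Suc m) j" unfolding std_words_def by blast
      ultimately show False using ex1_std_words[of w "Suc m" j] by (metis IntD1 IntD2 mem_Collect_eq)
    qed
  qed
  also have "\<dots> = (\<Sum>\<pi>\<in>?P. F \<pi> * (fps_X ^ (ides (Suc m) \<pi> + 1) * fps_ones ^ (m + 2)) $ j)"
  proof (rule sum.cong[OF refl])
    fix \<pi> assume "\<pi> \<in> ?P"
    then have \<pi>: "\<pi> permutes {1..Suc m}" by simp
    have "(\<Sum>w\<in>std_words (Suc m) j \<pi>. F w) = (\<Sum>w\<in>std_words (Suc m) j \<pi>. F \<pi>)"
      using assms[OF \<pi>] by (intro sum.cong) auto
    also have "\<dots> = F \<pi> * of_nat (card (descent_chains (descent (inv \<pi>)) (Suc m) j))"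
      by (simp add: card_std_words[OF \<pi>])
    finally show "(\<Sum>w\<in>std_words (Suc m) j \<pi>. F w) = F \<pi> * (fps_X ^ (ides (Suc m) \<pi> + 1) * fps_ones ^ (m + 2)) $ j"
      unfolding card_chains ides_eq_card .
  qed
  finally show ?thesis .
qed

section \<open>Permutations with odd cycles\<close>

text \<open>The ground set is arbitrary because the recurrence deletes points from it.\<close>

definition odd_cycle_perms :: "'a set \<Rightarrow> ('a \<Rightarrow> 'a) set" where
  "odd_cycle_perms S = {\<pi>. \<pi> permutes S \<and> (\<forall>C \<in> orbit \<pi> ` S. odd (card C))}"

definition cycle_count :: "'a set \<Rightarrow> ('a \<Rightarrow> 'a) \<Rightarrow> nat" where
  "cycle_count S \<pi> = card (orbit \<pi> ` S)"

lemma orbit_closed_subset: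
  assumes "x \<in> A" "\<And>y. y \<in> A \<Longrightarrow> f y \<in> A"
  shows "orbit f x \<subseteq> A"
proof
  fix y assume "y \<in> orbit f x"
  then show "y \<in> A" by induction (use assms in auto)
qed

text \<open>Composing with \<open>transpose b z\<close> inserts \<open>z\<close> immediately after \<open>b\<close> in the cycle of \<open>b\<close>.\<close>

lemma orbit_insert_after:
  assumes \<pi>: "\<pi> permutes S" and S: "finite S" and z: "z \<notin> S" and b: "b \<in> S"
  defines "\<rho> \<equiv> \<pi> \<circ> transpose b z"
  shows "\<rho> permutes insert z S"
    and "orbit \<rho> z = insert z (orbit \<pi> b)"
    and "x \<in> S \<Longrightarrow> orbit \<rho> x = (if x \<in> orbit \<pi> b then insert z (orbit \<pi> b) else orbit \<pi> x)"
proof -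
  have bz: "b \<noteq> z" using b z by auto
  have \<pi>z: "\<pi> z = z" using permutes_not_in[OF \<pi> z] .
  have "\<pi> permutes insert z S" using \<pi> by (rule permutes_subset) auto
  moreover have "transpose b z permutes insert z S" using b by (intro permutes_swap_id) auto
  ultimately show \<rho>: "\<rho> permutes insert z S" unfolding \<rho>_def by (intro permutes_compose)
  have \<rho>b: "\<rho> b = z" and \<rho>z: "\<rho> z = \<pi> b" and \<rho>x: "x \<noteq> b \<Longrightarrow> x \<noteq> z \<Longrightarrow> \<rho> x = \<pi> x" for x
    using \<pi>z by (auto simp: \<rho>_def transpose_def)
  have perm: "permutation \<pi>" "permutation \<rho>"
    using \<pi> \<rho> S by (auto simp: permutation_permutes)
  have self: "y \<in> orbit \<pi> y" "y \<in> orbit \<rho> y" for y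
    using perm by (auto intro: permutation_self_in_orbit)
  have eq: "orbit f y = orbit f x" if "y \<in> orbit f x" "permutation f" for f x and y :: 'a
    by (rule orbit_cyclic_eq3[OF cyclic_on_orbit'[OF that(2)] that(1)])
  show main: "orbit \<rho> z = insert z (orbit \<pi> b)"
  proof
    show "orbit \<rho> z \<subseteq> insert z (orbit \<pi> b)"
    proof (rule orbit_closed_subset)
      fix y assume "y \<in> insert z (orbit \<pi> b)"
      then show "\<rho> y \<in> insert z (orbit \<pi> b)"
        using \<rho>b \<rho>z \<rho>x[of y] by (cases "y = z"; cases "y = b") (auto intro: orbit.intros)
    qed simp
    have "\<pi> b \<in> orbit \<rho> z" using \<rho>z orbit.base[of \<rho> z] by simp
    have "orbit \<pi> b \<subseteq> orbit \<rho> z"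
    proof
      fix y assume "y \<in> orbit \<pi> b"
      then show "y \<in> orbit \<rho> z"
      proof induction
        case base
        show ?case by fact
      next
        case (step y)
        then show ?case
          using \<open>\<pi> b \<in> orbit \<rho> z\<close> \<rho>x[of y] \<pi>z self orbit.step[of y \<rho> z] by (cases "y = b"; cases "y = z") auto
      qed
    qed
    then show "insert z (orbit \<pi> b) \<subseteq> orbit \<rho> z" using self by auto
  qed
  assume x: "x \<in> S"
  show "orbit \<rho> x = (if x \<in> orbit \<pi> b then insert z (orbit \<pi> b) else orbit \<pi> x)"
  proof (cases "x \<in> orbit \<pi> b")
    case True
    then have "x \<in> orbit \<rho> z" using main by auto
    then have "orbit \<rho> x = orbit \<rho> z" using perm by (intro eq)
    then show ?thesis using True main by simp
  next
    case False
    have "b \<notin> orbit \<pi> x" using False eq[OF _ perm(1)] self by blast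
    moreover have "z \<notin> orbit \<pi> x" using permutes_orbit_subset[OF \<pi> x] z by auto
    ultimately have agree: "\<rho> y = \<pi> y" if "y \<in> orbit \<pi> x" for y
      using \<rho>x that by metis
    have "orbit \<rho> x \<subseteq> orbit \<pi> x"
      using agree self by (intro orbit_closed_subset) (auto intro: orbit.intros)
    moreover have "orbit \<pi> x \<subseteq> orbit \<rho> x"
    proof
      fix y assume "y \<in> orbit \<pi> x"
      then show "y \<in> orbit \<rho> x"
      proof induction
        case base
        show ?case using agree[of x] self orbit.base[of \<rho> x] by simp
      next
        case (step y)
        then show ?case using agree[of y] orbit.step[of y \<rho> x] by simp
      qed
    qed
    ultimately show ?thesis using False by simp
  qed
qed

text \<open>Only the cycle of \<open>b\<close> changes. As \<open>z\<close> lies in no old cycle,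
  the enlarged cycle differs from all of them, so the number of cycles is kept.\<close>

lemma orbits_insert_after:
  assumes \<pi>: "\<pi> permutes S" and S: "finite S" and z: "z \<notin> S" and b: "b \<in> S"
  shows "orbit (\<pi> \<circ> transpose b z) ` insert z S
    = insert (insert z (orbit \<pi> b)) (orbit \<pi> ` S - {orbit \<pi> b})"
    and "insert z (orbit \<pi> b) \<notin> orbit \<pi> ` S"
    and "card (insert z (orbit \<pi> b)) = Suc (card (orbit \<pi> b))"
proof -
  have perm: "permutation \<pi>" using \<pi> S by (auto simp: permutation_permutes)
  have self: "y \<in> orbit \<pi> y" for y using perm by (rule permutation_self_in_orbit)
  have eq: "x \<in> orbit \<pi> b \<longleftrightarrow> orbit \<pi> x = orbit \<pi> b" for x
    using self orbit_cyclic_eq3[OF cyclic_on_orbit'[OF perm], of x b] by blast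
  have sub: "orbit \<pi> x \<subseteq> S" if "x \<in> S" for x using permutes_orbit_subset[OF \<pi> that] .
  have "orbit (\<pi> \<circ> transpose b z) ` S = (\<lambda>x. if x \<in> orbit \<pi> b then insert z (orbit \<pi> b) else orbit \<pi> x) ` S"
    by (rule image_cong[OF refl]) (rule orbit_insert_after(3)[OF assms])
  also have "insert (insert z (orbit \<pi> b)) \<dots> = insert (insert z (orbit \<pi> b)) (orbit \<pi> ` S - {orbit \<pi> b})"
    unfolding eq by auto
  finally show "orbit (\<pi> \<circ> transpose b z) ` insert z S
    = insert (insert z (orbit \<pi> b)) (orbit \<pi> ` S - {orbit \<pi> b})"
    by (simp add: orbit_insert_after(2)[OF assms])
  show "insert z (orbit \<pi> b) \<notin> orbit \<pi> ` S" using sub z by blast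
  have "finite (orbit \<pi> b)" using sub[OF b] S by (rule finite_subset)
  moreover have "z \<notin> orbit \<pi> b" using sub[OF b] z by auto
  ultimately show "card (insert z (orbit \<pi> b)) = Suc (card (orbit \<pi> b))" by simp
qed

lemma cycle_count_insert_after:
  assumes "\<pi> permutes S" "finite S" "z \<notin> S" "b \<in> S"
  shows "cycle_count (insert z S) (\<pi> \<circ> transpose b z) = cycle_count S \<pi>"
proof -
  have "cycle_count (insert z S) (\<pi> \<circ> transpose b z) = Suc (card (orbit \<pi> ` S - {orbit \<pi> b}))"
    unfolding cycle_count_def orbits_insert_after(1)[OF assms]
    using assms orbits_insert_after(2)[OF assms] by (intro card_insert_disjoint) auto
  also have "\<dots> = card (orbit \<pi> ` S)" using assms by (intro card_Suc_Diff1) auto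
  finally show ?thesis by (simp add: cycle_count_def)
qed

text \<open>Inserting first \<open>a\<close> and then \<open>z\<close> produces
  \<open>b -> z -> a -> \<pi> b\<close>. One cycle grows by two, which preserves its parity.\<close>

lemma odd_cycles_insert_after_twice:
  assumes \<pi>: "\<pi> permutes S" and S: "finite S" and a: "a \<notin> S" and z: "z \<notin> insert a S" and b: "b \<in> S"
  shows "\<pi> \<circ> transpose b a \<circ> transpose b z \<in> odd_cycle_perms (insert z (insert a S))
    \<longleftrightarrow> \<pi> \<in> odd_cycle_perms S"
    and "cycle_count (insert z (insert a S)) (\<pi> \<circ> transpose b a \<circ> transpose b z) = cycle_count S \<pi>"
proof -
  let ?\<rho> = "\<pi> \<circ> transpose b a"
  note 1 = \<pi> S a b
  have \<rho>: "?\<rho> permutes insert a S" by (rule orbit_insert_after(1)[OF 1])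
  have b': "b \<in> insert a S" using b by simp
  note 2 = \<rho> finite.insertI[OF S] z b'
  show "cycle_count (insert z (insert a S)) (?\<rho> \<circ> transpose b z) = cycle_count S \<pi>"
    by (simp only: cycle_count_insert_after[OF 2] cycle_count_insert_after[OF 1])
  have self: "b \<in> orbit \<pi> b"
    using \<pi> S by (intro permutation_self_in_orbit) (auto simp: permutation_permutes)
  have orb: "orbit ?\<rho> b = insert a (orbit \<pi> b)"
    using orbit_insert_after(3)[OF 1 b] self by simp
  have "orbit ?\<rho> ` insert a S - {orbit ?\<rho> b} = orbit \<pi> ` S - {orbit \<pi> b}"
    unfolding orbits_insert_after(1)[OF 1] orb using orbits_insert_after(2)[OF 1] by auto
  then have "orbit (?\<rho> \<circ> transpose b z) ` insert z (insert a S)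
      = insert (insert z (insert a (orbit \<pi> b))) (orbit \<pi> ` S - {orbit \<pi> b})"
    unfolding orbits_insert_after(1)[OF 2] orb by simp
  moreover have "card (insert z (insert a (orbit \<pi> b))) = Suc (Suc (card (orbit \<pi> b)))"
    using orbits_insert_after(3)[OF 2] orbits_insert_after(3)[OF 1] orb by simp
  moreover have "(\<forall>C\<in>insert B (\<O> - {A}). odd (card C)) \<longleftrightarrow> (\<forall>C\<in>\<O>. odd (card C))"
    if "A \<in> \<O>" "card B = Suc (Suc (card A))" for A B :: "'a set" and \<O>
    using that by auto
  ultimately have "(\<forall>C\<in>orbit (?\<rho> \<circ> transpose b z) ` insert z (insert a S). odd (card C))
      \<longleftrightarrow> (\<forall>C\<in>orbit \<pi> ` S. odd (card C))"
    using b by (metis imageI)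
  then show "?\<rho> \<circ> transpose b z \<in> odd_cycle_perms (insert z (insert a S))
    \<longleftrightarrow> \<pi> \<in> odd_cycle_perms S"
    unfolding odd_cycle_perms_def using \<pi> orbit_insert_after(1)[OF 2] by blast
qed

section \<open>The recurrence for permutations with odd cycles\<close>

lemma finite_odd_cycle_perms [simp]: "finite S \<Longrightarrow> finite (odd_cycle_perms S)"
  unfolding odd_cycle_perms_def by (rule finite_subset[OF _ finite_permutations[of S]]) auto

lemma odd_cycle_perms_fixed:
  assumes S: "finite S" and z: "z \<notin> S"
  shows "{\<pi> \<in> odd_cycle_perms (insert z S). \<pi> z = z} = odd_cycle_perms S"
    and "\<pi> \<in> odd_cycle_perms S \<Longrightarrow> cycle_count (insert z S) \<pi> = Suc (cycle_count S \<pi>)"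
proof -
  have orb: "orbit \<pi> z = {z}" if "\<pi> z = z" for \<pi> :: "'a \<Rightarrow> 'a" using that by (simp add: orbit_eq_singleton_iff)
  have "\<pi> permutes insert z S \<and> \<pi> z = z \<longleftrightarrow> \<pi> permutes S" for \<pi>
    using z permutes_not_in[of \<pi> S z] permutes_subset[of \<pi> S "insert z S"]
    by (metis Diff_insert_absorb permutes_superset insert_iff subset_insertI Diff_iff)
  moreover have "odd (card (orbit \<pi> z))" if "\<pi> z = z" for \<pi>
    unfolding orb[of \<pi>, OF that] by simp
  ultimately show "{\<pi> \<in> odd_cycle_perms (insert z S). \<pi> z = z} = odd_cycle_perms S"
    unfolding odd_cycle_perms_def by blast
  assume "\<pi> \<in> odd_cycle_perms S"
  then have \<pi>: "\<pi> permutes S" by (simp add: odd_cycle_perms_def)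
  have "orbit \<pi> z = {z}" using orb permutes_not_in[OF \<pi> z] by simp
  moreover have "{z} \<notin> orbit \<pi> ` S" using permutes_orbit_subset[OF \<pi>] z by blast
  ultimately show "cycle_count (insert z S) \<pi> = Suc (cycle_count S \<pi>)"
    using S by (simp add: cycle_count_def)
qed

text \<open>A moved \<open>z\<close> lies in a cycle of odd length at least three, so its image
  \<open>a\<close> and its preimage \<open>b\<close> differ. Deleting \<open>z\<close> and
  \<open>a\<close> leaves odd cycles on \<open>S - {a}\<close>, and \<open>b\<close> records where
  to reinsert them.\<close>

lemma odd_cycle_perms_moved:
  assumes S: "finite S" and z: "z \<notin> S"
  shows "bij_betw (\<lambda>(a, b, \<pi>). \<pi> \<circ> transpose b a \<circ> transpose b z)
    (SIGMA a:S. (S - {a}) \<times> odd_cycle_perms (S - {a}))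
    {\<pi> \<in> odd_cycle_perms (insert z S). \<pi> z \<noteq> z}"
proof (rule bij_betw_imageI)
  let ?g = "\<lambda>(a, b, \<pi>). \<pi> \<circ> transpose b a \<circ> transpose b z"
  let ?A = "SIGMA a:S. (S - {a}) \<times> odd_cycle_perms (S - {a})"
  \<comment> \<open>Both \<open>a\<close> and \<open>b\<close> can be recovered, as image and
    preimage of \<open>z\<close>; this yields injectivity.\<close>
  have vals: "?g (a, b, \<pi>) z = a" "?g (a, b, \<pi>) b = z" if "(a, b, \<pi>) \<in> ?A" for a b \<pi>
  proof -
    have "\<pi> permutes S - {a}" "b \<noteq> a" "b \<noteq> z" "a \<noteq> z" using that z by (auto simp: odd_cycle_perms_def)
    then have "\<pi> a = a" "\<pi> z = z" using z by (auto intro: permutes_not_in)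
    then show "?g (a, b, \<pi>) z = a" "?g (a, b, \<pi>) b = z"
      using \<open>b \<noteq> a\<close> \<open>b \<noteq> z\<close> \<open>a \<noteq> z\<close> by (auto simp: transpose_def)
  qed
  show "inj_on ?g ?A"
  proof -
    have key: "a = a' \<and> b = b' \<and> \<pi> = \<pi>'" if A: "a \<in> S" "b \<in> S" "b \<notin> {a}" "\<pi> \<in> odd_cycle_perms (S - {a})"
      "a' \<in> S" "b' \<in> S" "b' \<notin> {a'}" "\<pi>' \<in> odd_cycle_perms (S - {a'})"
      and eq: "\<pi> \<circ> transpose b a \<circ> transpose b z = \<pi>' \<circ> transpose b' a' \<circ> transpose b' z" (is "?f = ?f'")
      for a b \<pi> a' b' \<pi>'
    proof -
      have f: "?f permutes insert z S"
      proof -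
        have "\<pi> permutes insert z S" using A(4) by (auto simp: odd_cycle_perms_def elim: permutes_subset)
        then show ?thesis using A by (intro permutes_compose permutes_swap_id) auto
      qed
      have "a = a'" using vals(1)[of a b \<pi>] vals(1)[of a' b' \<pi>'] A eq by simp
      moreover have "?f b = z" "?f' b' = z" using vals(2)[of a b \<pi>] vals(2)[of a' b' \<pi>'] A by auto
      then have "b = b'" using eq f by (metis permutes_inj injD)
      moreover have "\<pi> = ?f \<circ> transpose b z \<circ> transpose b a" "\<pi>' = ?f' \<circ> transpose b' z \<circ> transpose b' a'"
        by (simp_all add: fun_eq_iff)
      ultimately show "a = a' \<and> b = b' \<and> \<pi> = \<pi>'" using eq by metis
    qed
    show ?thesis
    proof (rule inj_onI)
      fix x y assume "x \<in> ?A" "y \<in> ?A" and g: "?g x = ?g y"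
      moreover obtain a b \<pi> a' b' \<pi>' where xy: "x = (a, b, \<pi>)" "y = (a', b', \<pi>')"
        by (metis prod_cases3)
      ultimately have A: "a \<in> S" "b \<in> S" "b \<notin> {a}" "\<pi> \<in> odd_cycle_perms (S - {a})"
          "a' \<in> S" "b' \<in> S" "b' \<notin> {a'}" "\<pi>' \<in> odd_cycle_perms (S - {a'})"
        by auto
      from key[OF A] g show "x = y" unfolding xy prod.case by blast
    qed
  qed
  show "?g ` ?A = {\<pi> \<in> odd_cycle_perms (insert z S). \<pi> z \<noteq> z}"
  proof (intro equalityI subsetI)
    fix \<rho> assume "\<rho> \<in> ?g ` ?A"
    then obtain a b \<pi> where A: "(a, b, \<pi>) \<in> ?A" and \<rho>: "\<rho> = \<pi> \<circ> transpose b a \<circ> transpose b z" by auto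
    have "insert a (S - {a}) = S" using A by auto
    moreover have "\<pi> permutes S - {a}" using A by (auto simp: odd_cycle_perms_def)
    ultimately have "\<rho> \<in> odd_cycle_perms (insert z S)"
      using odd_cycles_insert_after_twice(1)[of \<pi> "S - {a}" a z b] A \<rho> S z by auto
    moreover have "\<rho> z \<noteq> z" using vals(1)[OF A] \<rho> A z by auto
    ultimately show "\<rho> \<in> {\<pi> \<in> odd_cycle_perms (insert z S). \<pi> z \<noteq> z}" by simp
  next
    fix \<rho> assume "\<rho> \<in> {\<pi> \<in> odd_cycle_perms (insert z S). \<pi> z \<noteq> z}"
    then have odd: "\<rho> \<in> odd_cycle_perms (insert z S)" and "\<rho> z \<noteq> z" by auto
    then have \<rho>: "\<rho> permutes insert z S" by (simp add: odd_cycle_perms_def)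
    define a where "a = \<rho> z"
    define b where "b = inv \<rho> z"
    have \<rho>b: "\<rho> b = z" using permutes_inverses[OF \<rho>] by (simp add: b_def)
    have "a \<noteq> z" using \<open>\<rho> z \<noteq> z\<close> by (simp add: a_def)
    have "b \<noteq> z" using \<rho>b \<open>\<rho> z \<noteq> z\<close> by auto
    have "a \<in> S" using permutes_in_image[OF \<rho>, of z] \<open>a \<noteq> z\<close> by (simp add: a_def)
    have "b \<in> S" using permutes_in_image[OF \<rho>, of b] \<rho>b \<open>b \<noteq> z\<close> by simp
    \<comment> \<open>Otherwise \<open>z\<close> and \<open>a\<close> would form a cycle of even
      length two.\<close>
    have "a \<noteq> b"
    proof
      assume "a = b"
      have "orbit \<rho> z = {z, a}"
      proof
        show "orbit \<rho> z \<subseteq> {z, a}"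
          using \<rho>b \<open>a = b\<close> by (intro orbit_closed_subset) (auto simp: a_def)
        show "{z, a} \<subseteq> orbit \<rho> z"
          using orbit.base[of \<rho> z] orbit.step[of a \<rho> z] \<rho>b \<open>a = b\<close> by (auto simp: a_def)
      qed
      then have "card (orbit \<rho> z) = 2" using \<open>a \<noteq> z\<close> by simp
      then show False using odd by (auto simp: odd_cycle_perms_def)
    qed
    define \<pi> where "\<pi> = \<rho> \<circ> transpose b z \<circ> transpose b a"
    have \<rho>_eq: "\<rho> = \<pi> \<circ> transpose b a \<circ> transpose b z" by (simp add: \<pi>_def fun_eq_iff)
    have \<pi>': "\<pi> permutes insert z S"
      unfolding \<pi>_def using \<rho> \<open>a \<in> S\<close> \<open>b \<in> S\<close> by (intro permutes_compose permutes_swap_id) auto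
    have fixes_za: "\<pi> z = z" "\<pi> a = a"
      using \<rho>b \<open>a \<noteq> b\<close> \<open>a \<noteq> z\<close> \<open>b \<noteq> z\<close> by (auto simp: \<pi>_def transpose_def a_def)
    have \<pi>: "\<pi> permutes S - {a}"
      by (rule permutes_superset[OF \<pi>']) (use fixes_za in auto)
    have "insert a (S - {a}) = S" using \<open>a \<in> S\<close> by auto
    then have "\<pi> \<in> odd_cycle_perms (S - {a})"
      using odd_cycles_insert_after_twice(1)[OF \<pi>, of a z b] odd \<rho>_eq S z \<open>b \<in> S\<close> \<open>a \<noteq> b\<close> by auto
    then show "\<rho> \<in> ?g ` ?A"
      using \<rho>_eq \<open>a \<in> S\<close> \<open>b \<in> S\<close> \<open>a \<noteq> b\<close> by (intro image_eqI[of _ _ "(a, b, \<pi>)"]) auto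
  qed
qed

text \<open>For a set of size \<open>n + 1\<close>, a fixed \<open>z\<close> adds a cycle of weight
  \<open>2 * N\<close>, while a moved \<open>z\<close> gives \<open>n * (n - 1)\<close> choices of
  \<open>a\<close> and \<open>b\<close> and no new cycle. Divided by \<open>fact n\<close>, this
  recurrence is \<open>cayley_coeff_Suc_Suc\<close>.\<close>

lemma sum_odd_cycle_perms:
  assumes "finite S"
  shows "(\<Sum>\<pi>\<in>odd_cycle_perms S. (2 * N) ^ cycle_count S \<pi>) = fact (card S) * cayley_coeff N (card S)"
  using assms
proof (induction "card S" arbitrary: S rule: less_induct)
  case less
  let ?W = "\<lambda>S :: 'a set. \<Sum>\<pi>\<in>odd_cycle_perms S. (2 * N) ^ cycle_count S \<pi>"
  show ?case
  proof (cases "S = {}")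
    case True
    have "odd_cycle_perms {} = {id :: 'a \<Rightarrow> 'a}" by (auto simp: odd_cycle_perms_def)
    then show ?thesis using True by (simp add: cycle_count_def)
  next
    case False
    then obtain z where "z \<in> S" by auto
    define T where "T = S - {z}"
    have S: "S = insert z T" and z: "z \<notin> T" and T: "finite T"
      using \<open>z \<in> S\<close> \<open>finite S\<close> by (auto simp: T_def)
    define n where "n = card T"
    have card_S: "card S = Suc n" using S z T by (simp add: n_def)
    have IH: "?W R = fact (card R) * cayley_coeff N (card R)" if "finite R" "card R < card S" for R
      using less(1)[OF that(2,1)] .
    have fixed: "(\<Sum>\<pi> | \<pi> \<in> odd_cycle_perms S \<and> \<pi> z = z. (2 * N) ^ cycle_count S \<pi>) = 2 * N * ?W T"
      unfolding S odd_cycle_perms_fixed(1)[OF T z]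
      by (simp add: odd_cycle_perms_fixed(2)[OF T z] sum_distrib_left)
    have "(\<Sum>\<pi> | \<pi> \<in> odd_cycle_perms S \<and> \<pi> z \<noteq> z. (2 * N) ^ cycle_count S \<pi>)
        = (\<Sum>(a, b, \<pi>)\<in>(SIGMA a:T. (T - {a}) \<times> odd_cycle_perms (T - {a})). (2 * N) ^ cycle_count (T - {a}) \<pi>)"
      unfolding S
    proof (subst sum.reindex_bij_betw[OF odd_cycle_perms_moved[OF T z], symmetric], intro sum.cong refl)
      fix x assume "x \<in> (SIGMA a:T. (T - {a}) \<times> odd_cycle_perms (T - {a}))"
      then obtain a b \<pi> where x: "x = (a, b, \<pi>)" and a: "a \<in> T" and b: "b \<in> T - {a}"
        and \<pi>: "\<pi> permutes T - {a}"
        by (auto simp: odd_cycle_perms_def)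
      have "insert a (T - {a}) = T" using a by auto
      then show "(2 * N) ^ cycle_count (insert z T)
            (case x of (a, b, \<pi>) \<Rightarrow> \<pi> \<circ> transpose b a \<circ> transpose b z)
          = (case x of (a, b, \<pi>) \<Rightarrow> (2 * N) ^ cycle_count (T - {a}) \<pi>)"
        unfolding x prod.case
        using odd_cycles_insert_after_twice(2)[OF \<pi> _ _ _ b, of a z] T z by simp
    qed
    also have "\<dots> = (\<Sum>a\<in>T. \<Sum>b\<in>T - {a}. ?W (T - {a}))"
      using T by (simp add: sum.Sigma[symmetric] sum.cartesian_product[symmetric])
    also have "\<dots> = (\<Sum>a\<in>T. (n - 1) * (fact (n - 1) * cayley_coeff N (n - 1)))"
    proof (intro sum.cong refl)
      fix a assume "a \<in> T"
      then have card: "card (T - {a}) = n - 1" and "card (T - {a}) < card S"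
        using T card_S by (auto simp: n_def card_Diff_singleton)
      then have "?W (T - {a}) = fact (n - 1) * cayley_coeff N (n - 1)"
        using IH[of "T - {a}"] T by (simp only: card finite_Diff)
      then show "(\<Sum>b\<in>T - {a}. ?W (T - {a})) = (n - 1) * (fact (n - 1) * cayley_coeff N (n - 1))"
        by (simp only: sum_constant card of_nat_id)
    qed
    finally have moved: "(\<Sum>\<pi> | \<pi> \<in> odd_cycle_perms S \<and> \<pi> z \<noteq> z. (2 * N) ^ cycle_count S \<pi>)
        = n * (n - 1) * fact (n - 1) * cayley_coeff N (n - 1)"
      by (simp add: n_def)
    have "odd_cycle_perms S = {\<pi> \<in> odd_cycle_perms S. \<pi> z = z} \<union> {\<pi> \<in> odd_cycle_perms S. \<pi> z \<noteq> z}"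
      by auto
    then have "?W S = 2 * N * ?W T + n * (n - 1) * fact (n - 1) * cayley_coeff N (n - 1)"
      unfolding fixed[symmetric] moved[symmetric] using \<open>finite S\<close>
      by (subst (1) \<open>odd_cycle_perms S = _\<close>, intro sum.union_disjoint) auto
    also have "?W T = fact n * cayley_coeff N n"
      using IH[OF T] card_S unfolding n_def by simp
    also have "2 * N * (fact n * cayley_coeff N n) + n * (n - 1) * fact (n - 1) * cayley_coeff N (n - 1)
        = fact (Suc n) * cayley_coeff N (Suc n)"
    \<comment> \<open>For \<open>n = 0\<close> the truncated \<open>n - 1\<close> is harmless, as
      the factor \<open>n\<close> vanishes.\<close>
    proof (cases n)
      case (Suc k)
      have "fact (Suc n) * cayley_coeff N (Suc n) = fact n * ((k + 2) * cayley_coeff N (k + 2))"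
        by (simp add: Suc algebra_simps)
      also have "\<dots> = fact n * (2 * N * cayley_coeff N (k + 1) + k * cayley_coeff N k)"
        by (simp only: cayley_coeff_Suc_Suc)
      finally show ?thesis by (simp add: Suc algebra_simps)
    qed simp
    finally show ?thesis by (simp only: card_S)
  qed
qed

lemma sum_odd_cycle_number:
  "(\<Sum>k = 0..n. odd_cycle_number n k * (2 * N) ^ k) = fact n * cayley_coeff N n"
proof -
  let ?O = "odd_cycle_perms {1..n}"
  have "cycle_count {1..n} \<pi> \<le> n" for \<pi>
    unfolding cycle_count_def using card_image_le[of "{1..n}" "orbit \<pi>"] by simp
  then have "(\<Sum>\<pi>\<in>?O. (2 * N) ^ cycle_count {1..n} \<pi>)
      = (\<Sum>k = 0..n. \<Sum>\<pi> | \<pi> \<in> ?O \<and> cycle_count {1..n} \<pi> = k. (2 * N) ^ cycle_count {1..n} \<pi>)"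
    by (intro sum.group[symmetric]) auto
  also have "\<dots> = (\<Sum>k = 0..n. odd_cycle_number n k * (2 * N) ^ k)"
  proof (intro sum.cong refl)
    fix k
    have "odd_cycle_number n k = card {\<pi>. \<pi> \<in> ?O \<and> cycle_count {1..n} \<pi> = k}"
      unfolding odd_cycle_number_def odd_cycle_perms_def cycle_count_def
      by (rule arg_cong[where f = card]) blast
    then show "(\<Sum>\<pi> | \<pi> \<in> ?O \<and> cycle_count {1..n} \<pi> = k. (2 * N) ^ cycle_count {1..n} \<pi>)
        = odd_cycle_number n k * (2 * N) ^ k" by simp
  qed
  finally show ?thesis using sum_odd_cycle_perms[of "{1..n}" N] by simp
qed

section \<open>Series in three variables\<close>

text \<open>A ring homomorphism into the variable \<open>s\<close>, the middle level of the nested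
  type; \<open>embed_t\<close> does the same for the innermost level \<open>t\<close>. One-variable
  identities transfer along both.\<close>

definition embed_s :: "rat fps \<Rightarrow> fps3" where
  "embed_s f = fps_const (Abs_fps (\<lambda>i. fps_const (f $ i)))"

definition embed_t :: "rat fps \<Rightarrow> fps3" where
  "embed_t f = fps_const (fps_const f)"

lemma embed_s_mult: "embed_s (f * g) = embed_s f * embed_s g"
  by (simp add: embed_s_def fps_eq_iff fps_mult_nth fps_sum_nth)

lemma embed_s_simps [simp]:
  "embed_s 0 = 0" "embed_s 1 = 1" "embed_s fps_X = X\<^sub>s" "embed_s (fps_const c) = fps_const (fps_const (fps_const c))"
  "embed_s (f + g) = embed_s f + embed_s g" "embed_s (f - g) = embed_s f - embed_s g"
  by (auto simp: embed_s_def X\<^sub>s_def fps_eq_iff )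

lemma embed_t_simps [simp]:
  "embed_t 0 = 0" "embed_t 1 = 1" "embed_t fps_X = X\<^sub>t" 
  "embed_t (f + g) = embed_t f + embed_t g" "embed_t (f - g) = embed_t f - embed_t g"
  "embed_t (f * g) = embed_t f * embed_t g" "embed_t (f ^ n) = embed_t f ^ n"
  by (auto simp: embed_t_def X\<^sub>t_def fps_const_power)

lemma embed_nth:
  "(embed_s f * embed_t g) $ m $ p $ q = (if m = 0 then f $ p * g $ q else 0)"
  by (simp add: embed_s_def embed_t_def)

lemma embed_s_power [simp]: "embed_s (f ^ n) = embed_s f ^ n"
  by (induction n) (simp_all add: embed_s_mult)

lemma embed_sum: "embed_s (sum f A) = (\<Sum>a\<in>A. embed_s (f a))" "embed_t (sum f A) = (\<Sum>a\<in>A. embed_t (f a))"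
  by (induction A rule: infinite_finite_induct) simp_all

lemma embed_inverse:
  "embed_s fps_ones * (1 - X\<^sub>s) = 1" "embed_t fps_ones * (1 - X\<^sub>t) = 1"
proof -
  have "embed_s (fps_ones * (1 - fps_X)) = 1" "embed_t (fps_ones * (1 - fps_X)) = 1"
    by simp_all
  then show "embed_s fps_ones * (1 - X\<^sub>s) = 1" "embed_t fps_ones * (1 - X\<^sub>t) = 1"
    by (simp_all only: embed_s_mult embed_s_simps embed_t_simps)
qed

lemma X_nth [simp]: "X\<^sub>s $ 0 $ 0 = 0" "X\<^sub>t $ 0 $ 0 $ 0 = 0" "X\<^sub>x $ 0 = 0"
  by (simp_all add: X\<^sub>s_def X\<^sub>t_def X\<^sub>x_def)

lemma fps3_divide_eqI:
  fixes f g h :: fps3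
  assumes "g $ 0 $ 0 $ 0 \<noteq> 0" "h * g = f"
  shows "f / g = h"
proof -
  have "f / g * g = h * g" using fps3_divide_mult[OF assms(1)] assms(2) by simp
  moreover have "g \<noteq> 0" using assms(1) by auto
  ultimately show ?thesis by simp
qed

lemma fps3_of_nat_mult_nth: "((of_nat c :: fps3) * f) $ m $ p $ q = of_nat c * f $ m $ p $ q"
  by (simp add: fps_of_nat[symmetric])

lemma fps3_one_divide_of_nat:
  assumes "c \<noteq> 0"
  shows "1 / of_nat c * (of_nat c * f) = (f :: fps3)"
proof -
  have "(of_nat c :: fps3) $ 0 $ 0 $ 0 \<noteq> 0"
    using assms by (simp add: fps_of_nat[symmetric])
  from fps3_divide_mult[OF this, of 1] show ?thesis
    by (simp add: mult.assoc[symmetric])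
qed

text \<open>Each coefficient receives a contribution from at most one index. This index is
  \<open>n\<close> when the summands carry distinct powers of \<open>x\<close>, and
  \<open>(i, j)\<close> when they carry distinct monomials in \<open>s\<close> and
  \<open>t\<close>.\<close>

lemma formal_sum_concentrated:
  assumes "\<And>n i j l. l \<in> I \<Longrightarrow> l \<noteq> h n i j \<Longrightarrow> f l $ n $ i $ j = 0"
  shows "formal_summable f I"
    and "formal_sum f I $ n $ i $ j = (if h n i j \<in> I then f (h n i j) $ n $ i $ j else 0)"
proof -
  have sub: "{l \<in> I. f l $ n $ i $ j \<noteq> 0} \<subseteq> {h n i j}" for n i j
    using assms by blast
  show "formal_summable f I"
    unfolding formal_summable_def using sub by (meson finite.emptyI finite.insertI finite_subset)
  have "(\<Sum>l | l \<in> I \<and> f l $ n $ i $ j \<noteq> 0. f l $ n $ i $ j)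
      = (\<Sum>l\<in>(if h n i j \<in> I then {h n i j} else {}). f l $ n $ i $ j)"
    using sub[of n i j] by (intro sum.mono_neutral_left) (auto split: if_splits)
  then show "formal_sum f I $ n $ i $ j = (if h n i j \<in> I then f (h n i j) $ n $ i $ j else 0)"
    by (simp add: formal_sum_def)
qed

lemma peak_factors:
  "(1 + X\<^sub>s) / ((1 - X\<^sub>s) * (1 - X\<^sub>t)) = embed_s cayley_fps * embed_t fps_ones"
  "4 * X\<^sub>s / (1 + X\<^sub>s)\<^sup>2 = embed_s peak_weight"
proof -
  show "(1 + X\<^sub>s) / ((1 - X\<^sub>s) * (1 - X\<^sub>t)) = embed_s cayley_fps * embed_t fps_ones"
  proof (rule fps3_divide_eqI)
    have "embed_s cayley_fps * embed_t fps_ones * ((1 - X\<^sub>s) * (1 - X\<^sub>t))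
        = (1 + X\<^sub>s) * (embed_s fps_ones * (1 - X\<^sub>s)) * (embed_t fps_ones * (1 - X\<^sub>t))"
      by (simp only: cayley_fps_def embed_s_mult embed_s_simps mult_ac)
    then show "embed_s cayley_fps * embed_t fps_ones * ((1 - X\<^sub>s) * (1 - X\<^sub>t)) = 1 + X\<^sub>s"
      by (simp add: embed_inverse)
  qed simp
  show "4 * X\<^sub>s / (1 + X\<^sub>s)\<^sup>2 = embed_s peak_weight"
  proof (rule fps3_divide_eqI)
    have "embed_s (peak_weight * (1 + fps_X) * (1 + fps_X)) = embed_s (fps_const 4 * fps_X)"
      by (simp only: peak_weight_mult numeral_fps_const)
    then show "embed_s peak_weight * (1 + X\<^sub>s)\<^sup>2 = 4 * X\<^sub>s"
      by (simp add: embed_s_mult power2_eq_square mult.assoc numeral_fps_const)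
  qed (simp add: power2_eq_square)
qed

section \<open>Coefficients of the scaled polynomial and of the Eulerian quotients\<close>

lemma pk_eq_peaks:
  assumes "\<pi> permutes {1..Suc m}"
  shows "pk (Suc m) \<pi> = peaks (descent \<pi>) m"
proof -
  have "\<not> descent \<pi> (i - 1) \<longleftrightarrow> \<pi> (i - 1) < \<pi> i" if "i \<ge> 2" for i
  proof -
    have "\<pi> (i - 1) \<noteq> \<pi> i" using injD[OF permutes_inj[OF assms], of "i - 1" i] that by auto
    then show ?thesis using that by (auto simp: descent_def)
  qed
  then show ?thesis
    unfolding pk_def peaks_def by (intro arg_cong[where f = card]) (auto simp: descent_def)
qed

definition scaled_pk_ides :: "nat \<Rightarrow> fps3" where
  "scaled_pk_ides n = ((1 + X\<^sub>s) / ((1 - X\<^sub>s) * (1 - X\<^sub>t))) ^ (n + 1)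
     * pk_ides_poly n (4 * X\<^sub>s / (1 + X\<^sub>s)\<^sup>2) X\<^sub>t"

text \<open>In each summand the \<open>s\<close>-part is twice an enriched P-partition series, and
  the \<open>t\<close>-part generates the fibre sizes of standardization. The sum over permutations
  thus becomes one over words, evaluated by \<open>sum_words_enriched_fps\<close>.\<close>

lemma scaled_pk_ides_nth:
  assumes "n \<ge> 1"
  shows "scaled_pk_ides n $ l $ p $ q = (if l = 0 then 2 * of_nat (cayley_coeff (p * q) n) else 0)"
proof -
  obtain m where n: "n = Suc m" using assms by (cases n) auto
  define F where "F w = ((fst (enriched_fps (descent w) m) + snd (enriched_fps (descent w) m)) * fps_ones) $ p" for w
  have "scaled_pk_ides n = (\<Sum>\<pi> | \<pi> permutes {1..Suc m}.
      embed_s (2 * ((fst (enriched_fps (descent \<pi>) m) + snd (enriched_fps (descent \<pi>) m)) * fps_ones))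
      * embed_t (fps_X ^ (ides (Suc m) \<pi> + 1) * fps_ones ^ (m + 2)))"
    unfolding scaled_pk_ides_def pk_ides_poly_def peak_factors sum_distrib_left n
  proof (intro sum.cong refl)
    fix \<pi> assume "\<pi> \<in> {\<pi>. \<pi> permutes {1..Suc m}}"
    then have pk: "pk (Suc m) \<pi> = peaks (descent \<pi>) m" using pk_eq_peaks by simp
    show "(embed_s cayley_fps * embed_t fps_ones) ^ (Suc m + 1) *
         (embed_s peak_weight ^ (pk (Suc m) \<pi> + 1) * X\<^sub>t ^ (ides (Suc m) \<pi> + 1)) =
         embed_s (2 * ((fst (enriched_fps (descent \<pi>) m) + snd (enriched_fps (descent \<pi>) m)) * fps_ones))
         * embed_t (fps_X ^ (ides (Suc m) \<pi> + 1) * fps_ones ^ (m + 2))"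
      unfolding enriched_fps_total_sums pk
      by (simp add: embed_s_mult power_mult_distrib mult_ac)
  qed
  then have "scaled_pk_ides n $ l $ p $ q = (if l = 0 then
      2 * (\<Sum>\<pi> | \<pi> permutes {1..Suc m}. F \<pi> * (fps_X ^ (ides (Suc m) \<pi> + 1) * fps_ones ^ (m + 2)) $ q) else 0)"
    by (simp only: fps_sum_nth embed_nth F_def) (simp add: sum_distrib_left mult.assoc numeral_fps_const)
  also have "(\<Sum>\<pi> | \<pi> permutes {1..Suc m}. F \<pi> * (fps_X ^ (ides (Suc m) \<pi> + 1) * fps_ones ^ (m + 2)) $ q)
      = (\<Sum>w\<in>words (Suc m) q. F w)"
  proof (rule sum_words_by_standardization[symmetric])
    fix w \<pi> assume "\<pi> permutes {1..Suc m}" "w \<in> std_words (Suc m) q \<pi>"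
    then have "enriched_fps (descent w) m = enriched_fps (descent \<pi>) m"
      by (intro enriched_fps_cong descent_std_words) auto
    then show "F w = F \<pi>" by (simp only: F_def)
  qed
  also have "\<dots> = of_nat (cayley_coeff (p * q) n)"
    unfolding F_def n by (rule sum_words_enriched_fps)
  finally show ?thesis .
qed

text \<open>Standardization with the constant statistic 1 counts the \<open>i ^ k\<close> words of
  length \<open>k\<close> over \<open>{1..i}\<close>.\<close>

lemma eulerian_poly_fps_nth:
  "(eulerian_poly k fps_X * fps_ones ^ (k + 1) :: rat fps) $ i = of_nat i ^ k"
proof (cases k)
  case 0
  then show ?thesis by (simp add: eulerian_poly_def)
next
  case (Suc m)
  \<comment> \<open>Inversion of permutations exchanges \<open>des\<close> and
    \<open>ides\<close>.\<close>
  have "(\<Sum>\<pi> | \<pi> permutes {1..Suc m}. fps_X ^ (des (Suc m) \<pi> + 1) :: rat fps)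
      = (\<Sum>\<pi> | \<pi> permutes {1..Suc m}. fps_X ^ (ides (Suc m) \<pi> + 1))"
    unfolding ides_def
    by (rule sum.reindex_bij_witness[of _ inv inv]) (auto simp: permutes_inv permutes_inv_inv)
  then have "eulerian_poly k fps_X * fps_ones ^ (k + 1)
      = (\<Sum>\<pi> | \<pi> permutes {1..Suc m}. fps_X ^ (ides (Suc m) \<pi> + 1) * fps_ones ^ (m + 2) :: rat fps)"
    by (simp add: eulerian_poly_def Suc sum_distrib_right)
  then have "(eulerian_poly k fps_X * fps_ones ^ (k + 1) :: rat fps) $ i
      = (\<Sum>\<pi> | \<pi> permutes {1..Suc m}. 1 * (fps_X ^ (ides (Suc m) \<pi> + 1) * fps_ones ^ (m + 2)) $ i)"
    by (simp only: fps_sum_nth mult_1)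
  also have "\<dots> = (\<Sum>w\<in>words (Suc m) i. 1)"
    by (rule sum_words_by_standardization[symmetric]) simp
  also have "\<dots> = of_nat i ^ k"
    by (simp add: card_funcsetE Suc)
  finally show ?thesis .
qed

lemma embed_eulerian_poly:
  "embed_s (eulerian_poly k fps_X) = eulerian_poly k X\<^sub>s"
  "embed_t (eulerian_poly k fps_X) = eulerian_poly k X\<^sub>t"
  by (simp_all add: eulerian_poly_def embed_sum embed_s_mult)

lemma eulerian_quotient_nth:
  "(eulerian_poly k X\<^sub>s * eulerian_poly k X\<^sub>t / ((1 - X\<^sub>s) ^ (k + 1) * (1 - X\<^sub>t) ^ (k + 1))) $ l $ p $ q
     = (if l = 0 then of_nat (p * q) ^ k else 0)"
proof -
  let ?E = "eulerian_poly k fps_X * fps_ones ^ (k + 1)"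
  have "eulerian_poly k X\<^sub>s * eulerian_poly k X\<^sub>t / ((1 - X\<^sub>s) ^ (k + 1) * (1 - X\<^sub>t) ^ (k + 1))
      = embed_s ?E * embed_t ?E"
  proof (rule fps3_divide_eqI)
    have "embed_s ?E * embed_t ?E * ((1 - X\<^sub>s) ^ (k + 1) * (1 - X\<^sub>t) ^ (k + 1))
        = eulerian_poly k X\<^sub>s * eulerian_poly k X\<^sub>t * (embed_s fps_ones * (1 - X\<^sub>s)) ^ (k + 1)
          * (embed_t fps_ones * (1 - X\<^sub>t)) ^ (k + 1)"
      by (simp only: embed_s_mult embed_t_simps embed_s_power embed_eulerian_poly power_mult_distrib mult_ac)
    then show "embed_s ?E * embed_t ?E * ((1 - X\<^sub>s) ^ (k + 1) * (1 - X\<^sub>t) ^ (k + 1))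
        = eulerian_poly k X\<^sub>s * eulerian_poly k X\<^sub>t"
      by (simp only: embed_inverse power_one mult_1_right)
  qed (simp add: fps_power_zeroth)
  then show ?thesis
    by (simp only: embed_nth eulerian_poly_fps_nth of_nat_mult power_mult_distrib)
qed

section \<open>The three identities\<close>

lemma monomial_nth:
  fixes f :: fps3
  assumes "f $ n = of_nat c"
  shows "(f * X\<^sub>s ^ i * X\<^sub>t ^ j) $ n $ p $ q = (if p = i \<and> q = j then of_nat c else 0)"
  using assms by (simp add: X\<^sub>s_def X\<^sub>t_def fps_of_nat[symmetric] fps_X_power_nth)

text \<open>Here the series is taken in the outermost variable \<open>x\<close>, over the ring of
  series in \<open>s\<close> and \<open>t\<close>.\<close>

lemma cayley_quotient: "(1 + X\<^sub>x) / (1 - X\<^sub>x) = (cayley_fps :: fps3)"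
proof (rule fps3_divide_eqI)
  have "cayley_fps * (1 - X\<^sub>x) = (1 + fps_X) * (fps_ones * (1 - fps_X) :: fps3)"
    by (simp only: cayley_fps_def X\<^sub>x_def mult_ac)
  then show "cayley_fps * (1 - X\<^sub>x) = 1 + X\<^sub>x" by (simp add: X\<^sub>x_def)
qed simp

text \<open>At positive powers of \<open>x\<close> both sides reduce to \<open>cayley_coeff\<close>.
  At \<open>x^0\<close>, where \<open>cayley_coeff\<close> is 1, the double geometric series is
  supplied by the separate first summand.\<close>

lemma scaled_pk_ides_generating_function:
  "formal_summable (\<lambda>n. scaled_pk_ides n * X\<^sub>x ^ n) {1..}"
  "formal_summable (\<lambda>(i, j). ((1 + X\<^sub>x) / (1 - X\<^sub>x)) ^ (i * j) * X\<^sub>s ^ i * X\<^sub>t ^ j) UNIV"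
  "1 / ((1 - X\<^sub>s) * (1 - X\<^sub>t)) + 1 / 2 * formal_sum (\<lambda>n. scaled_pk_ides n * X\<^sub>x ^ n) {1..}
    = formal_sum (\<lambda>(i, j). ((1 + X\<^sub>x) / (1 - X\<^sub>x)) ^ (i * j) * X\<^sub>s ^ i * X\<^sub>t ^ j) UNIV"
proof -
  let ?f = "\<lambda>n. scaled_pk_ides n * X\<^sub>x ^ n"
  let ?g = "\<lambda>(i, j). ((1 + X\<^sub>x) / (1 - X\<^sub>x)) ^ (i * j) * X\<^sub>s ^ i * X\<^sub>t ^ j"
  have f: "?f n $ l $ p $ q = (if l = n then 2 * of_nat (cayley_coeff (p * q) n) else 0)" if "n \<ge> 1" for n l p q
    using that by (auto simp: X\<^sub>x_def fps_X_power_mult_right_nth scaled_pk_ides_nth)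
  have g: "?g (i, j) $ n $ p $ q = (if p = i \<and> q = j then of_nat (cayley_coeff (i * j) n) else 0)" for i j n p q
    unfolding prod.case cayley_quotient by (rule monomial_nth) (rule cayley_fps_power_nth)
  have f_conc: "?f l $ n $ i $ j = 0" if "l \<in> {1..}" "l \<noteq> n" for n i j l
    using f[of l n i j] that by simp
  have g_conc: "?g l $ n $ i $ j = 0" if "l \<in> UNIV" "l \<noteq> (i, j)" for n i j l
    using g[of "fst l" "snd l" n i j] that by (cases l) auto
  show "formal_summable ?f {1..}" by (rule formal_sum_concentrated(1)[OF f_conc])
  show "formal_summable ?g UNIV" by (rule formal_sum_concentrated(1)[OF g_conc])
  have "1 / ((1 - X\<^sub>s) * (1 - X\<^sub>t)) = embed_s fps_ones * embed_t fps_ones"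
  proof (rule fps3_divide_eqI)
    have "embed_s fps_ones * embed_t fps_ones * ((1 - X\<^sub>s) * (1 - X\<^sub>t))
        = (embed_s fps_ones * (1 - X\<^sub>s)) * (embed_t fps_ones * (1 - X\<^sub>t))"
      by (simp only: mult_ac)
    then show "embed_s fps_ones * embed_t fps_ones * ((1 - X\<^sub>s) * (1 - X\<^sub>t)) = 1"
      by (simp only: embed_inverse mult_1)
  qed simp
  moreover have "formal_sum ?f {1..} = of_nat 2 * (formal_sum ?g UNIV - embed_s fps_ones * embed_t fps_ones)"
  proof (intro fps_ext)
    fix n p q
    have "formal_sum ?f {1..} $ n $ p $ q = (if n \<ge> 1 then 2 * of_nat (cayley_coeff (p * q) n) else 0)"
      by (subst formal_sum_concentrated(2)[where h = "\<lambda>n _ _. n", OF f_conc]) (simp_all add: f)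
    moreover have "formal_sum ?g UNIV $ n $ p $ q = of_nat (cayley_coeff (p * q) n)"
      by (subst formal_sum_concentrated(2)[where h = "\<lambda>_ i j. (i, j)", OF g_conc])
         (simp_all only: g UNIV_I if_True simp_thms)
    ultimately show "formal_sum ?f {1..} $ n $ p $ q
        = (of_nat 2 * (formal_sum ?g UNIV - embed_s fps_ones * embed_t fps_ones)) $ n $ p $ q"
      unfolding fps3_of_nat_mult_nth fps_sub_nth embed_nth by (cases n) simp_all
  qed
  moreover have "1 / 2 * (of_nat 2 * f) = f" for f :: fps3
    using fps3_one_divide_of_nat[of 2 f, OF zero_neq_numeral[symmetric]] by (simp only: of_nat_numeral)
  ultimately show "1 / ((1 - X\<^sub>s) * (1 - X\<^sub>t)) + 1 / 2 * formal_sum ?f {1..} = formal_sum ?g UNIV"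
    by (simp only: add_diff_eq add_diff_cancel_left')
qed

lemma scaled_pk_ides_eq_binomial_sum:
  assumes "n \<ge> 1"
  shows "formal_summable (\<lambda>(i, j). \<Sum>k = 0..n. of_nat (i * j choose k)
              * of_nat (i * j + n - k - 1 choose (n - k)) * X\<^sub>s ^ i * X\<^sub>t ^ j) UNIV"
    and "scaled_pk_ides n = 2 * formal_sum (\<lambda>(i, j). \<Sum>k = 0..n. of_nat (i * j choose k)
              * of_nat (i * j + n - k - 1 choose (n - k)) * X\<^sub>s ^ i * X\<^sub>t ^ j) UNIV"
proof -
  let ?g = "\<lambda>(i, j). \<Sum>k = 0..n. of_nat (i * j choose k)
              * of_nat (i * j + n - k - 1 choose (n - k)) * X\<^sub>s ^ i * X\<^sub>t ^ j"
  have "?g (i, j) = of_nat (cayley_coeff (i * j) n) * X\<^sub>s ^ i * X\<^sub>t ^ j" for i j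
    by (simp add: cayley_coeff_def sum_distrib_right)
  then have g: "?g (i, j) $ l $ p $ q
      = (if p = i \<and> q = j then of_nat (if l = 0 then cayley_coeff (i * j) n else 0) else 0)" for i j l p q
    by (simp only:) (rule monomial_nth, simp add: fps_of_nat[symmetric])
  have g_conc: "?g x $ l $ i $ j = 0" if "x \<in> UNIV" "x \<noteq> (i, j)" for l i j x
    using g[of "fst x" "snd x" l i j] that by (cases x) auto
  show "formal_summable ?g UNIV" by (rule formal_sum_concentrated(1)[OF g_conc])
  have "scaled_pk_ides n = of_nat 2 * formal_sum ?g UNIV"
  proof (intro fps_ext)
    fix l p q
    have "formal_sum ?g UNIV $ l $ p $ q = of_nat (if l = 0 then cayley_coeff (p * q) n else 0)"
      by (subst formal_sum_concentrated(2)[where h = "\<lambda>_ i j. (i, j)", OF g_conc])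
         (simp_all only: g UNIV_I if_True simp_thms)
    then show "scaled_pk_ides n $ l $ p $ q = (of_nat 2 * formal_sum ?g UNIV) $ l $ p $ q"
      unfolding fps3_of_nat_mult_nth scaled_pk_ides_nth[OF assms] by simp
  qed
  then show "scaled_pk_ides n = 2 * formal_sum ?g UNIV" by simp
qed

text \<open>The quotient for \<open>k\<close> has coefficient \<open>(p * q) ^ k\<close>, so
  \<open>sum_odd_cycle_number\<close> with \<open>N = p * q\<close> evaluates the sum; one factor 2
  of \<open>2 ^ (k + 1)\<close> remains outside.\<close>

lemma scaled_pk_ides_eq_eulerian_sum:
  assumes "n \<ge> 1"
  shows "scaled_pk_ides n = 1 / fact n * (\<Sum>k = 0..n. 2 ^ (k + 1) * of_nat (odd_cycle_number n k)
            * (eulerian_poly k X\<^sub>s * eulerian_poly k X\<^sub>t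
               / ((1 - X\<^sub>s) ^ (k + 1) * (1 - X\<^sub>t) ^ (k + 1))))" (is "_ = _ * ?S")
proof -
  \<comment> \<open>The factorial is cleared first, so that coefficients are compared without
    division.\<close>
  have "?S = of_nat (fact n) * scaled_pk_ides n"
  proof (intro fps_ext)
    fix l p q
    have "?S $ l $ p $ q = (\<Sum>k = 0..n. of_nat (2 ^ (k + 1) * odd_cycle_number n k) * (if l = 0 then of_nat (p * q) ^ k else 0))"
      unfolding fps_sum_nth
    proof (intro sum.cong refl)
      fix k
      have "(2 ^ (k + 1) * of_nat (odd_cycle_number n k) :: fps3) = of_nat (2 ^ (k + 1) * odd_cycle_number n k)"
        by simp
      then show "(2 ^ (k + 1) * of_nat (odd_cycle_number n k)
            * (eulerian_poly k X\<^sub>s * eulerian_poly k X\<^sub>t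
               / ((1 - X\<^sub>s) ^ (k + 1) * (1 - X\<^sub>t) ^ (k + 1)))) $ l $ p $ q
          = of_nat (2 ^ (k + 1) * odd_cycle_number n k) * (if l = 0 then of_nat (p * q) ^ k else 0)"
        by (simp only: fps3_of_nat_mult_nth eulerian_quotient_nth)
    qed
    also have "\<dots> = (if l = 0 then 2 * of_nat (\<Sum>k = 0..n. odd_cycle_number n k * (2 * (p * q)) ^ k) else 0)"
      by (simp add: sum_distrib_left power_mult_distrib mult_ac)
    also have "\<dots> = (of_nat (fact n) * scaled_pk_ides n) $ l $ p $ q"
      unfolding sum_odd_cycle_number fps3_of_nat_mult_nth scaled_pk_ides_nth[OF assms] by simp
    finally show "?S $ l $ p $ q = (of_nat (fact n) * scaled_pk_ides n) $ l $ p $ q" .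
  qed
  then show ?thesis
    using fps3_one_divide_of_nat[of "fact n" "scaled_pk_ides n"] by simp
qed

theorem theorem3p6:
  shows
    "(formal_summable
        (\<lambda>n. ((1 + X\<^sub>s) / ((1 - X\<^sub>s) * (1 - X\<^sub>t))) ^ (n + 1)
              * pk_ides_poly n (4 * X\<^sub>s / (1 + X\<^sub>s)\<^sup>2) X\<^sub>t * X\<^sub>x ^ n) {1..} \<and>
      formal_summable
        (\<lambda>(i, j). ((1 + X\<^sub>x) / (1 - X\<^sub>x)) ^ (i * j) * X\<^sub>s ^ i * X\<^sub>t ^ j) UNIV \<and>
      1 / ((1 - X\<^sub>s) * (1 - X\<^sub>t))
        + 1 / 2 * formal_sum
            (\<lambda>n. ((1 + X\<^sub>s) / ((1 - X\<^sub>s) * (1 - X\<^sub>t))) ^ (n + 1)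
                  * pk_ides_poly n (4 * X\<^sub>s / (1 + X\<^sub>s)\<^sup>2) X\<^sub>t * X\<^sub>x ^ n) {1..}
      = formal_sum
          (\<lambda>(i, j). ((1 + X\<^sub>x) / (1 - X\<^sub>x)) ^ (i * j) * X\<^sub>s ^ i * X\<^sub>t ^ j) UNIV)
     \<and>
     (\<forall>n::nat. n \<ge> 1 \<longrightarrow>
        formal_summable
          (\<lambda>(i, j). \<Sum>k = 0..n. of_nat (i * j choose k)
              * of_nat (i * j + n - k - 1 choose (n - k)) * X\<^sub>s ^ i * X\<^sub>t ^ j) UNIV \<and>
        ((1 + X\<^sub>s) / ((1 - X\<^sub>s) * (1 - X\<^sub>t))) ^ (n + 1)
          * pk_ides_poly n (4 * X\<^sub>s / (1 + X\<^sub>s)\<^sup>2) X\<^sub>t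
        = 2 * formal_sum
            (\<lambda>(i, j). \<Sum>k = 0..n. of_nat (i * j choose k)
                * of_nat (i * j + n - k - 1 choose (n - k)) * X\<^sub>s ^ i * X\<^sub>t ^ j) UNIV)
     \<and>
     (\<forall>n::nat. n \<ge> 1 \<longrightarrow>
        ((1 + X\<^sub>s) / ((1 - X\<^sub>s) * (1 - X\<^sub>t))) ^ (n + 1)
          * pk_ides_poly n (4 * X\<^sub>s / (1 + X\<^sub>s)\<^sup>2) X\<^sub>t
        = 1 / fact n * (\<Sum>k = 0..n. 2 ^ (k + 1) * of_nat (odd_cycle_number n k)
            * (eulerian_poly k X\<^sub>s * eulerian_poly k X\<^sub>t
               / ((1 - X\<^sub>s) ^ (k + 1) * (1 - X\<^sub>t) ^ (k + 1)))))"
  using scaled_pk_ides_generating_function scaled_pk_ides_eq_binomial_sum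
    scaled_pk_ides_eq_eulerian_sum
  unfolding scaled_pk_ides_def by blast

end
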